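(* Let $A$ be a connected, $1$-finite cdga. Suppose $\mathcal{R}^1_1(A)=\bigcup_{C\in\mathcal{C}}C$, a finite union of linear subspaces of $H^1(A)$. For each $C\in\mathcal{C}$, let $A_C$ denote the sub-cdga of the truncation $A^{\le 2}$ defined by $A^1_C=C$ and $A^2_C=A^2$. Then, for any finite-dimensional Lie algebra $\mathfrak{g}$, $$\mathcal{F}(A,\mathfrak{g})\supseteq\mathcal{F}^1(A,\mathfrak{g})\cup\bigcup_{0\ne C\in\mathcal{C}}\mathcal{F}(A_C,\mathfrak{g}),\qquad(\ast)$$ where each $\mathcal{F}(A_C,\mathfrak{g})$ is Zariski-closed in $\mathcal{F}(A,\mathfrak{g})$. Moreover, if $A$ has zero differential, $A^1$ is non-zero, and $\mathfrak{g}=\mathfrak{sl}_2$ or $\mathfrak{sol}_2$, then $(\ast)$ holds as an equality, and, for any finite-dimensional representation $\theta\colon\mathfrak{g}\to\mathfrak{gl}(V)$ with $V\ne0$, $$\mathcal{R}^1_1(A,\theta)=\Pi(A,\theta)\cup\bigcup_{0\ne C\in\mathcal{C}}\mathcal{F}(A_C,\mathfrak{g}).$$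
   Context: Everything is over $\mathbb{C}$. A cdga is a (graded-)commutative, non-negatively graded differential graded algebra $A=(A^\bullet,d)$; it is connected if $A^0=\mathbb{C}\cdot1$, and $1$-finite if it is connected and $A^1$ is finite-dimensional. $A^{\le2}=A/A^{>2}$ is the degree-$2$ truncation; $A_C$ has $A_C^0=\mathbb{C}\cdot 1$ and $A_C^{>2}=0$. $\mathfrak{sol}_2$ is the standard Borel subalgebra of $\mathfrak{sl}_2$ (upper triangular traceless matrices). Flat connections: $A\otimes\mathfrak{g}$ has bracket $[\alpha\otimes x,\beta\otimes y]=\alpha\beta\otimes[x,y]$ and differential $\partial(\alpha\otimes x)=d\alpha\otimes x$; $\mathcal{F}(A,\mathfrak{g})=\{\omega\in A^1\otimes\mathfrak{g}\mid\partial\omega+\frac12[\omega,\omega]=0\}$, a Zariski-closed subset of $A^1\otimes\mathfrak{g}$ when $A^1$ and $\mathfrak{g}$ are finite-dimensional. $\mathcal{F}(A_C,\mathfrak{g})$ is viewed inside $\mathcal{F}(A,\mathfrak{g})$ via $C\otimes\mathfrak{g}\subseteq A^1\otimes\mathfrak{g}$. For $\theta\colon\mathfrak{g}\to\mathfrak{gl}(V)$ and $\omega=\sum_i\eta_i\otimes g_i\in\mathcal{F}(A,\mathfrak{g})$, put $d_\omega(\alpha\otimes v)=d\alpha\otimes v+\sum_i\eta_i\alpha\otimes\theta(g_i)v$ on $A\otimes V$, and $\mathcal{R}^i_r(A,\theta)=\{\omega\in\mathcal{F}(A,\mathfrak{g})\mid\dim_{\mathbb{C}}H^i(A\otimes V,d_\omega)\ge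 r\}$. For $\mathfrak{g}=\mathbb{C}$, $\theta=\mathrm{id}_{\mathbb{C}}$, write $\mathcal{R}^i_r(A)$; it is a subset of $\mathcal{F}(A,\mathbb{C})=\{\alpha\in A^1\mid d\alpha=0\}=H^1(A)$. $\mathcal{F}^1(A,\mathfrak{g})$ is the set of all tensors $\eta\otimes g$ with $\eta\in A^1$, $d\eta=0$, $g\in\mathfrak{g}$. $\Pi(A,\theta)$ is the set of all such tensors for which in addition $\det(\theta(g))=0$. *)

theory Defs
  imports
    "HOL-Analysis.Determinants"
    "HOL-Library.Poly_Mapping"
    "HOL-Library.Extended_Nat"
    "Jordan_Normal_Form.Determinant"
begin

section \<open>Complex vector spaces\<close>

class scaleC =
  fixes scaleC :: "complex \<Rightarrow> 'a \<Rightarrow> 'a" (infixr \<open>*\<^sub>C\<close> 75)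

class complex_vector = scaleC + ab_group_add +
  assumes scaleC_add_right: "a *\<^sub>C (x + y) = a *\<^sub>C x + a *\<^sub>C y"
    and scaleC_add_left: "(a + b) *\<^sub>C x = a *\<^sub>C x + b *\<^sub>C x"
    and scaleC_scaleC: "a *\<^sub>C (b *\<^sub>C x) = (a * b) *\<^sub>C x"
    and scaleC_one: "1 *\<^sub>C x = x"

global_interpretation complex_vector:
  vector_space "scaleC :: complex \<Rightarrow> 'a \<Rightarrow> 'a::complex_vector"
  defines csubspace_raw_def: csubspace = complex_vector.subspace
    and cspan_raw_def: cspan = complex_vector.span
    and cdependent_raw_def: cdependent = complex_vector.dependent
    and crepresentation_raw_def: crepresentation = complex_vector.representation
  by unfold_locales (fact scaleC_add_right scaleC_add_left scaleC_scaleC scaleC_one)+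

instantiation complex :: complex_vector
begin
definition scaleC_complex :: "complex \<Rightarrow> complex \<Rightarrow> complex"
  where "scaleC_complex a x = a * x"
instance
  by standard (simp_all add: scaleC_complex_def algebra_simps)
end

instantiation Finite_Cartesian_Product.vec :: (complex_vector, finite) complex_vector
begin
definition scaleC_vec :: "complex \<Rightarrow> ('a, 'b) Finite_Cartesian_Product.vec \<Rightarrow> ('a, 'b) Finite_Cartesian_Product.vec"
  where "scaleC_vec a x = (\<chi> i. a *\<^sub>C vec_nth x i)"
instance
  by standard (simp_all add: scaleC_vec_def Finite_Cartesian_Product.vec_eq_iff
      scaleC_add_right scaleC_add_left scaleC_scaleC scaleC_one)
end

instantiation poly_mapping :: (type, complex_vector) complex_vector
begin
lift_definition scaleC_poly_mapping :: "complex \<Rightarrow> ('a \<Rightarrow>\<^sub>0 'b) \<Rightarrow> ('a \<Rightarrow>\<^sub>0 'b)"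
  is "\<lambda>a p k. a *\<^sub>C p k"
  subgoal for a p by (rule finite_subset[of _ "{k. p k \<noteq> 0}"]) auto
  done
instance
  by standard (transfer; simp add: fun_eq_iff scaleC_add_right scaleC_add_left scaleC_scaleC scaleC_one)+
end

definition fin_dim :: "'a::complex_vector set \<Rightarrow> bool"
  where "fin_dim S \<longleftrightarrow> (\<exists>B. finite B \<and> S = cspan B)"

definition linear_on :: "'a::complex_vector set \<Rightarrow> ('a \<Rightarrow> 'b::complex_vector) \<Rightarrow> bool"
  where "linear_on S f \<longleftrightarrow>
    (\<forall>x\<in>S. \<forall>y\<in>S. f (x + y) = f x + f y) \<and> (\<forall>c. \<forall>x\<in>S. f (c *\<^sub>C x) = c *\<^sub>C f x)"

definition bilinear_on ::
    "'a::complex_vector set \<Rightarrow> 'b::complex_vector set \<Rightarrow> ('a \<Rightarrow> 'b \<Rightarrow> 'c::complex_vector) \<Rightarrow> bool"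
  where "bilinear_on S T f \<longleftrightarrow>
    (\<forall>y\<in>T. linear_on S (\<lambda>x. f x y)) \<and> (\<forall>x\<in>S. linear_on T (f x))"

text \<open>The dimension of the quotient of a space \<open>Z\<close> by a subspace \<open>B\<close>: the supremum of the sizes
  of the finite subsets of \<open>Z\<close> that are linearly independent modulo \<open>B\<close>.\<close>

definition quotient_dim :: "'a::complex_vector set \<Rightarrow> 'a set \<Rightarrow> enat"
  where "quotient_dim Z B =
    (SUP S\<in>{S. finite S \<and> S \<subseteq> Z \<and> (\<forall>c. (\<Sum>s\<in>S. c s *\<^sub>C s) \<in> B \<longrightarrow> (\<forall>s\<in>S. c s = 0))}. enat (card S))"

text \<open>The determinant of an endomorphism of a finite-dimensional space is the determinant of its
  matrix in some (equivalently, any) ordered basis.\<close>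

definition endo_det :: "('v::complex_vector \<Rightarrow> 'v) \<Rightarrow> complex"
  where "endo_det f =
    (let bs = (SOME bs. distinct bs \<and> \<not> cdependent (set bs) \<and> cspan (set bs) = UNIV);
         n = length bs
     in Determinant.det (Matrix.mat n n (\<lambda>(i, j). crepresentation (set bs) (f (bs ! j)) (bs ! i))))"


section \<open>Zariski-closed subsets\<close>

inductive_set polynomial_functions :: "('a::complex_vector \<Rightarrow> complex) set"
  where
    const: "(\<lambda>x. c) \<in> polynomial_functions"
  | linear: "linear_on UNIV f \<Longrightarrow> f \<in> polynomial_functions"
  | add: "p \<in> polynomial_functions \<Longrightarrow> q \<in> polynomial_functions \<Longrightarrow> (\<lambda>x. p x + q x) \<in> polynomial_functions"
  | mult: "p \<in> polynomial_functions \<Longrightarrow> q \<in> polynomial_functions \<Longrightarrow> (\<lambda>x. p x * q x) \<in> polynomial_functions"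

text \<open>Used only for subsets \<open>X\<close> of a finite-dimensional subspace \<open>W\<close> of the ambient type.  The
  polynomial functions on \<open>W\<close> are the restrictions of those on the type, since linear functionals
  extend.\<close>

definition zariski_closed_in :: "'a::complex_vector set \<Rightarrow> 'a set \<Rightarrow> bool"
  where "zariski_closed_in X Z \<longleftrightarrow>
    (\<exists>P\<subseteq>polynomial_functions. Z = {x \<in> X. \<forall>p\<in>P. p x = 0})"


section \<open>Tensor products\<close>

definition tensor_relations :: "('a::complex_vector \<times> 'b::complex_vector \<Rightarrow>\<^sub>0 complex) set"
  where "tensor_relations =
    {Poly_Mapping.single (x + x', y) 1 - Poly_Mapping.single (x, y) 1 - Poly_Mapping.single (x', y) 1 | x x' y. True} \<union>
    {Poly_Mapping.single (x, y + y') 1 - Poly_Mapping.single (x, y) 1 - Poly_Mapping.single (x, y') 1 | x y y'. True} \<union>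
    {Poly_Mapping.single (c *\<^sub>C x, y) 1 - Poly_Mapping.single (x, y) c | c x y. True} \<union>
    {Poly_Mapping.single (x, c *\<^sub>C y) 1 - Poly_Mapping.single (x, y) c | c x y. True}"

quotient_type (overloaded) ('a, 'b) tensor =
  "'a::complex_vector \<times> 'b::complex_vector \<Rightarrow>\<^sub>0 complex" / "\<lambda>p q. p - q \<in> cspan tensor_relations"
proof (rule equivpI)
  show "reflp (\<lambda>p q :: 'a \<times> 'b \<Rightarrow>\<^sub>0 complex. p - q \<in> cspan tensor_relations)"
    by (auto intro!: reflpI simp: complex_vector.span_zero)
  show "symp (\<lambda>p q :: 'a \<times> 'b \<Rightarrow>\<^sub>0 complex. p - q \<in> cspan tensor_relations)"
  proof (rule sympI)
    fix p q :: "'a \<times> 'b \<Rightarrow>\<^sub>0 complex"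
    assume "p - q \<in> cspan tensor_relations"
    from complex_vector.span_neg[OF this] show "q - p \<in> cspan tensor_relations" by simp
  qed
  show "transp (\<lambda>p q :: 'a \<times> 'b \<Rightarrow>\<^sub>0 complex. p - q \<in> cspan tensor_relations)"
  proof (rule transpI)
    fix p q r :: "'a \<times> 'b \<Rightarrow>\<^sub>0 complex"
    assume "p - q \<in> cspan tensor_relations" "q - r \<in> cspan tensor_relations"
    from complex_vector.span_add[OF this] show "p - r \<in> cspan tensor_relations" by simp
  qed
qed

instantiation tensor :: (complex_vector, complex_vector) complex_vector
begin

lift_definition zero_tensor :: "('a, 'b) tensor" is 0 .

lift_definition plus_tensor :: "('a, 'b) tensor \<Rightarrow> ('a, 'b) tensor \<Rightarrow> ('a, 'b) tensor" is "(+)"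
  subgoal for p p' q q'
    using complex_vector.span_add[of "p - p'" tensor_relations "q - q'"]
    by (simp add: algebra_simps)
  done

lift_definition minus_tensor :: "('a, 'b) tensor \<Rightarrow> ('a, 'b) tensor \<Rightarrow> ('a, 'b) tensor" is "(-)"
  subgoal for p p' q q'
    using complex_vector.span_diff[of "p - p'" tensor_relations "q - q'"]
    by (simp add: algebra_simps)
  done

lift_definition uminus_tensor :: "('a, 'b) tensor \<Rightarrow> ('a, 'b) tensor" is "uminus"
  subgoal for p q
    using complex_vector.span_neg[of "p - q" tensor_relations]
    by (simp add: algebra_simps)
  done

lift_definition scaleC_tensor :: "complex \<Rightarrow> ('a, 'b) tensor \<Rightarrow> ('a, 'b) tensor" is "scaleC"
  subgoal for c p q
    using complex_vector.span_scale[of "p - q" tensor_relations c]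
    by (simp add: complex_vector.scale_right_diff_distrib)
  done

instance
  by standard (transfer; simp add: complex_vector.span_zero add.assoc add.commute
      scaleC_add_right scaleC_add_left scaleC_scaleC scaleC_one)+

end

lift_definition tens :: "'a::complex_vector \<Rightarrow> 'b::complex_vector \<Rightarrow> ('a, 'b) tensor" (infixl \<open>\<otimes>\<^sub>C\<close> 72)
  is "\<lambda>x y. Poly_Mapping.single (x, y) 1" .

text \<open>For subspaces \<open>S\<close> and \<open>T\<close>, the canonical map from the tensor product of \<open>S\<close> and \<open>T\<close> to that
  of the ambient spaces is injective; the following set is its image.\<close>

definition tensor_space :: "'a::complex_vector set \<Rightarrow> 'b::complex_vector set \<Rightarrow> ('a, 'b) tensor set"
  where "tensor_space S T = cspan {x \<otimes>\<^sub>C y | x y. x \<in> S \<and> y \<in> T}"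

text \<open>The linear map on \<open>tensor_space S T\<close> with \<open>x \<otimes>\<^sub>C y \<mapsto> f x y\<close>, for a map \<open>f\<close> that is bilinear on
  \<open>S \<times> T\<close>; see \<open>tensor_lift_sum_list\<close> below.\<close>

definition tensor_lift ::
    "'a::complex_vector set \<Rightarrow> 'b::complex_vector set \<Rightarrow> ('a \<Rightarrow> 'b \<Rightarrow> 'c::complex_vector) \<Rightarrow>
     ('a, 'b) tensor \<Rightarrow> 'c"
  where "tensor_lift S T f t =
    (THE w. \<exists>zs. set zs \<subseteq> S \<times> T \<and> t = (\<Sum>(x, y)\<leftarrow>zs. x \<otimes>\<^sub>C y) \<and> w = (\<Sum>(x, y)\<leftarrow>zs. f x y))"

lemma tens_add_left: "(x + x') \<otimes>\<^sub>C y = x \<otimes>\<^sub>C y + x' \<otimes>\<^sub>C y"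
proof (transfer)
  fix x x' :: 'a and y :: 'b
  have "Poly_Mapping.single (x + x', y) (1::complex) - Poly_Mapping.single (x, y) 1 - Poly_Mapping.single (x', y) 1
      \<in> cspan tensor_relations"
    unfolding tensor_relations_def by (rule complex_vector.span_base) blast
  then show "Poly_Mapping.single (x + x', y) (1::complex) - (Poly_Mapping.single (x, y) 1 + Poly_Mapping.single (x', y) 1)
      \<in> cspan tensor_relations"
    by (simp add: diff_diff_eq)
qed

lemma tens_add_right: "x \<otimes>\<^sub>C (y + y') = x \<otimes>\<^sub>C y + x \<otimes>\<^sub>C y'"
proof (transfer)
  fix x :: 'a and y y' :: 'b
  have "Poly_Mapping.single (x, y + y') (1::complex) - Poly_Mapping.single (x, y) 1 - Poly_Mapping.single (x, y') 1
      \<in> cspan tensor_relations"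
    unfolding tensor_relations_def by (rule complex_vector.span_base) blast
  then show "Poly_Mapping.single (x, y + y') (1::complex) - (Poly_Mapping.single (x, y) 1 + Poly_Mapping.single (x, y') 1)
      \<in> cspan tensor_relations"
    by (simp add: diff_diff_eq)
qed

lemma scaleC_single: "c *\<^sub>C Poly_Mapping.single k a = Poly_Mapping.single k (c *\<^sub>C a)"
  by (transfer) (auto simp: when_def)

lemma tens_scaleC_left: "(c *\<^sub>C x) \<otimes>\<^sub>C y = c *\<^sub>C (x \<otimes>\<^sub>C y)"
proof (transfer)
  fix c and x :: 'a and y :: 'b
  have "Poly_Mapping.single (c *\<^sub>C x, y) (1::complex) - Poly_Mapping.single (x, y) c \<in> cspan tensor_relations"
    unfolding tensor_relations_def by (rule complex_vector.span_base) blast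
  then show "Poly_Mapping.single (c *\<^sub>C x, y) (1::complex) - c *\<^sub>C Poly_Mapping.single (x, y) 1 \<in> cspan tensor_relations"
    by (simp add: scaleC_single scaleC_complex_def)
qed

lemma tens_scaleC_right: "x \<otimes>\<^sub>C (c *\<^sub>C y) = c *\<^sub>C (x \<otimes>\<^sub>C y)"
proof (transfer)
  fix c and x :: 'a and y :: 'b
  have "Poly_Mapping.single (x, c *\<^sub>C y) (1::complex) - Poly_Mapping.single (x, y) c \<in> cspan tensor_relations"
    unfolding tensor_relations_def by (rule complex_vector.span_base) blast
  then show "Poly_Mapping.single (x, c *\<^sub>C y) (1::complex) - c *\<^sub>C Poly_Mapping.single (x, y) 1 \<in> cspan tensor_relations"
    by (simp add: scaleC_single scaleC_complex_def)
qed

lemma linear_on_UNIV_iff: "linear_on UNIV f \<longleftrightarrow> Vector_Spaces.linear scaleC scaleC f"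
  by (auto simp: linear_on_def Vector_Spaces.linear_def module_hom_def module_hom_axioms_def
      complex_vector.module_axioms complex_vector.vector_space_axioms)

lemma tensor_universal_property:
  fixes f :: "'a::complex_vector \<Rightarrow> 'b::complex_vector \<Rightarrow> 'c::complex_vector"
  assumes "bilinear_on UNIV UNIV f"
  shows "\<exists>F. linear_on UNIV F \<and> (\<forall>x y. F (x \<otimes>\<^sub>C y) = f x y)"
proof -
  define G :: "('a \<times> 'b \<Rightarrow>\<^sub>0 complex) \<Rightarrow> 'c" where
    "G p = (\<Sum>k\<in>Poly_Mapping.keys p. Poly_Mapping.lookup p k *\<^sub>C f (fst k) (snd k))" for p
  have G_eq: "G p = (\<Sum>k\<in>K. Poly_Mapping.lookup p k *\<^sub>C f (fst k) (snd k))"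
    if "finite K" "Poly_Mapping.keys p \<subseteq> K" for p K
    unfolding G_def using that by (intro sum.mono_neutral_left) (auto simp: in_keys_iff)
  have G_add: "G (p + q) = G p + G q" for p q
  proof -
    let ?K = "Poly_Mapping.keys p \<union> Poly_Mapping.keys q"
    have "G (p + q) = (\<Sum>k\<in>?K. Poly_Mapping.lookup (p + q) k *\<^sub>C f (fst k) (snd k))"
      by (intro G_eq Poly_Mapping.keys_add) auto
    also have "\<dots> = (\<Sum>k\<in>?K. Poly_Mapping.lookup p k *\<^sub>C f (fst k) (snd k))
        + (\<Sum>k\<in>?K. Poly_Mapping.lookup q k *\<^sub>C f (fst k) (snd k))"
      by (simp add: lookup_add scaleC_add_left sum.distrib)
    also have "\<dots> = G p + G q"
      by (subst (1 2) G_eq[of ?K]) auto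
    finally show ?thesis .
  qed
  have G_scale: "G (c *\<^sub>C p) = c *\<^sub>C G p" for c p
  proof -
    have "G (c *\<^sub>C p) = (\<Sum>k\<in>Poly_Mapping.keys p. Poly_Mapping.lookup (c *\<^sub>C p) k *\<^sub>C f (fst k) (snd k))"
      by (intro G_eq) (auto simp: in_keys_iff scaleC_poly_mapping.rep_eq)
    also have "\<dots> = c *\<^sub>C G p"
      by (simp add: G_def scaleC_poly_mapping.rep_eq scaleC_complex_def complex_vector.scale_sum_right)
    finally show ?thesis .
  qed
  have G_diff: "G (p - q) = G p - G q" for p q
    using G_add[of "p - q" q] by simp
  have G_single: "G (Poly_Mapping.single k c) = c *\<^sub>C f (fst k) (snd k)" for k c
    by (simp add: G_def)
  have rel: "G r = 0" if "r \<in> tensor_relations" for r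
    using that assms
    by (auto simp: tensor_relations_def G_diff G_single bilinear_on_def linear_on_def)
  have G0: "G r = 0" if "r \<in> cspan tensor_relations" for r
    using that
  proof (induction rule: complex_vector.span_induct_alt)
    case base
    show ?case by (simp add: G_def)
  next
    case (step c x y)
    then show ?case by (simp add: G_add G_scale rel)
  qed
  define F where "F t = G (rep_tensor t)" for t
  have F_abs: "F (abs_tensor p) = G p" for p
  proof -
    have "rep_tensor (abs_tensor p) - p \<in> cspan tensor_relations"
      using Quotient3_rep_abs[OF Quotient3_tensor] complex_vector.span_zero
      by (metis (mono_tags, lifting) cancel_comm_monoid_add_class.diff_cancel)
    from G0[OF this] show ?thesis by (simp add: F_def G_diff)
  qed
  have "linear_on UNIV F"
    unfolding linear_on_def
  proof (intro conjI ballI allI)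
    fix s t :: "('a, 'b) tensor" and c
    obtain p q where "s = abs_tensor p" "t = abs_tensor q"
      by (metis Quotient3_abs_rep[OF Quotient3_tensor])
    then show "F (s + t) = F s + F t" "F (c *\<^sub>C s) = c *\<^sub>C F s"
      by (simp_all add: plus_tensor.abs_eq scaleC_tensor.abs_eq F_abs G_add G_scale)
  qed
  moreover have "F (x \<otimes>\<^sub>C y) = f x y" for x y
    by (simp add: tens.abs_eq F_abs G_single scaleC_one)
  ultimately show ?thesis by blast
qed

lemma linear_projection:
  fixes S :: "'a::complex_vector set"
  assumes "csubspace S"
  shows "\<exists>p. linear_on UNIV p \<and> range p \<subseteq> S \<and> (\<forall>x\<in>S. p x = x)"
proof -
  interpret vector_space_pair "scaleC :: complex \<Rightarrow> 'a \<Rightarrow> 'a" "scaleC :: complex \<Rightarrow> 'a \<Rightarrow> 'a"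
    by unfold_locales
  from linear_exists_left_inverse_on[OF complex_vector.linear_id, of S] assms
  show ?thesis by (fastforce simp: linear_on_UNIV_iff csubspace_raw_def)
qed

lemma tensor_lift_sum_list:
  fixes f :: "'a::complex_vector \<Rightarrow> 'b::complex_vector \<Rightarrow> 'c::complex_vector"
  assumes S: "csubspace S" and T: "csubspace T" and f: "bilinear_on S T f" and zs: "set zs \<subseteq> S \<times> T"
  shows "tensor_lift S T f (\<Sum>(x, y)\<leftarrow>zs. x \<otimes>\<^sub>C y) = (\<Sum>(x, y)\<leftarrow>zs. f x y)"
proof -
  obtain p where p: "linear_on UNIV p" "range p \<subseteq> S" "\<And>x. x \<in> S \<Longrightarrow> p x = x"
    using linear_projection[OF S] by blast
  obtain q where q: "linear_on UNIV q" "range q \<subseteq> T" "\<And>x. x \<in> T \<Longrightarrow> q x = x"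
    using linear_projection[OF T] by blast
  have pS: "p x \<in> S" and qT: "q y \<in> T" for x y
    using p(2) q(2) by auto
  have "bilinear_on UNIV UNIV (\<lambda>x y. f (p x) (q y))"
    using f p(1) q(1) pS qT by (simp add: bilinear_on_def linear_on_def)
  from tensor_universal_property[OF this]
  obtain F where F: "linear_on UNIV F" "\<And>x y. F (x \<otimes>\<^sub>C y) = f (p x) (q y)" by blast
  have F_add: "F (s + t) = F s + F t" for s t
    using F(1) by (simp add: linear_on_def)
  have F0: "F 0 = 0"
    using F_add[of 0 0] by simp
  have F_sum: "F (\<Sum>(x, y)\<leftarrow>ws. x \<otimes>\<^sub>C y) = (\<Sum>(x, y)\<leftarrow>ws. f x y)" if "set ws \<subseteq> S \<times> T" for ws
    using that by (induction ws) (auto simp: F0 F_add F(2) p(3) q(3))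
  show ?thesis
    unfolding tensor_lift_def
  proof (rule the_equality)
    show "\<exists>ws. set ws \<subseteq> S \<times> T \<and> (\<Sum>(x, y)\<leftarrow>zs. x \<otimes>\<^sub>C y) = (\<Sum>(x, y)\<leftarrow>ws. x \<otimes>\<^sub>C y)
        \<and> (\<Sum>(x, y)\<leftarrow>zs. f x y) = (\<Sum>(x, y)\<leftarrow>ws. f x y)"
      using zs by blast
  next
    fix w
    assume "\<exists>ws. set ws \<subseteq> S \<times> T \<and> (\<Sum>(x, y)\<leftarrow>zs. x \<otimes>\<^sub>C y) = (\<Sum>(x, y)\<leftarrow>ws. x \<otimes>\<^sub>C y)
        \<and> w = (\<Sum>(x, y)\<leftarrow>ws. f x y)"
    then show "w = (\<Sum>(x, y)\<leftarrow>zs. f x y)"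
      using F_sum zs by metis
  qed
qed

lemma tensor_space_sum_list:
  assumes S: "csubspace S" and t: "t \<in> tensor_space S T"
  shows "\<exists>zs. set zs \<subseteq> S \<times> T \<and> t = (\<Sum>(x, y)\<leftarrow>zs. x \<otimes>\<^sub>C y)"
  using t unfolding tensor_space_def
proof (induction rule: complex_vector.span_induct_alt)
  case base
  show ?case by (rule exI[of _ "[]"]) simp
next
  case (step c t u)
  then obtain x y zs where "t = x \<otimes>\<^sub>C y" "x \<in> S" "y \<in> T" "set zs \<subseteq> S \<times> T"
      "u = (\<Sum>(x, y)\<leftarrow>zs. x \<otimes>\<^sub>C y)"
    by blast
  then show ?case
    using S by (intro exI[of _ "(c *\<^sub>C x, y) # zs"])
      (auto simp: tens_scaleC_left complex_vector.subspace_scale)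
qed


section \<open>Commutative differential graded algebras\<close>

text \<open>A non-negatively graded algebra is given as the family of its homogeneous components, with
  the product \<open>product A i j\<close> from degrees \<open>i\<close>, \<open>j\<close> to degree \<open>i + j\<close> and the differential
  \<open>differential A i\<close> from degree \<open>i\<close> to degree \<open>i + 1\<close>.  The components are subspaces of one ambient
  space; all operations are constrained only on the components.\<close>

record 'a dga =
  component :: "nat \<Rightarrow> 'a set"
  product :: "nat \<Rightarrow> nat \<Rightarrow> 'a \<Rightarrow> 'a \<Rightarrow> 'a"
  unity :: 'a
  differential :: "nat \<Rightarrow> 'a \<Rightarrow> 'a"

locale cdga =
  fixes A :: "'a::complex_vector dga"
  assumes subspace_component: "csubspace (component A i)"
    and product_closed:
      "x \<in> component A i \<Longrightarrow> y \<in> component A j \<Longrightarrow> product A i j x y \<in> component A (i + j)"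
    and bilinear_product: "bilinear_on (component A i) (component A j) (product A i j)"
    and product_assoc:
      "x \<in> component A i \<Longrightarrow> y \<in> component A j \<Longrightarrow> z \<in> component A k \<Longrightarrow>
        product A (i + j) k (product A i j x y) z = product A i (j + k) x (product A j k y z)"
    and unity_closed: "unity A \<in> component A 0"
    and product_unity_left: "x \<in> component A i \<Longrightarrow> product A 0 i (unity A) x = x"
    and product_unity_right: "x \<in> component A i \<Longrightarrow> product A i 0 x (unity A) = x"
    and product_commute:
      "x \<in> component A i \<Longrightarrow> y \<in> component A j \<Longrightarrow>
        product A j i y x = (-1) ^ (i * j) *\<^sub>C product A i j x y"
    and differential_closed: "x \<in> component A i \<Longrightarrow> differential A i x \<in> component A (Suc i)"
    and linear_differential: "linear_on (component A i) (differential A i)"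
    and differential_differential:
      "x \<in> component A i \<Longrightarrow> differential A (Suc i) (differential A i x) = 0"
    and leibniz:
      "x \<in> component A i \<Longrightarrow> y \<in> component A j \<Longrightarrow>
        differential A (i + j) (product A i j x y) =
          product A (Suc i) j (differential A i x) y +
          (-1) ^ i *\<^sub>C product A i (Suc j) x (differential A j y)"

definition connected_dga :: "'a::complex_vector dga \<Rightarrow> bool"
  where "connected_dga A \<longleftrightarrow> component A 0 = cspan {unity A} \<and> unity A \<noteq> 0"

definition one_finite :: "'a::complex_vector dga \<Rightarrow> bool"
  where "one_finite A \<longleftrightarrow> connected_dga A \<and> fin_dim (component A 1)"

text \<open>\<open>H1 A\<close> is the space of 1-cocycles; it is the first cohomology of \<open>A\<close> for connected \<open>A\<close>, where
  \<open>differential A 0\<close> vanishes.\<close>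

definition H1 :: "'a::complex_vector dga \<Rightarrow> 'a set"
  where "H1 A = {\<alpha> \<in> component A 1. differential A 1 \<alpha> = 0}"

text \<open>The quotient of \<open>A\<close> by the ideal of elements of degree above 2.\<close>

definition truncation2 :: "'a::complex_vector dga \<Rightarrow> 'a dga"
  where "truncation2 A = A
    \<lparr>component := (\<lambda>i. if i \<le> 2 then component A i else {0}),
     product := (\<lambda>i j x y. if i + j \<le> 2 then product A i j x y else 0),
     differential := (\<lambda>i x. if Suc i \<le> 2 then differential A i x else 0)\<rparr>"

definition sub_dga :: "'a::complex_vector dga \<Rightarrow> 'a set \<Rightarrow> 'a dga"
  where "sub_dga A C = (truncation2 A)
    \<lparr>component := (\<lambda>i. if i = 0 then cspan {unity A} else if i = 1 then C
       else if i = 2 then component A 2 else {0})\<rparr>"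


section \<open>Lie algebras and representations\<close>

record 'g lie =
  lie_space :: "'g set"
  bracket :: "'g \<Rightarrow> 'g \<Rightarrow> 'g"

locale lie_algebra =
  fixes L :: "'g::complex_vector lie"
  assumes subspace_lie_space: "csubspace (lie_space L)"
    and bracket_closed: "x \<in> lie_space L \<Longrightarrow> y \<in> lie_space L \<Longrightarrow> bracket L x y \<in> lie_space L"
    and bilinear_bracket: "bilinear_on (lie_space L) (lie_space L) (bracket L)"
    and bracket_self: "x \<in> lie_space L \<Longrightarrow> bracket L x x = 0"
    and jacobi:
      "x \<in> lie_space L \<Longrightarrow> y \<in> lie_space L \<Longrightarrow> z \<in> lie_space L \<Longrightarrow>
        bracket L x (bracket L y z) + bracket L y (bracket L z x) + bracket L z (bracket L x y) = 0"

definition sl2 :: "(complex ^ 2 ^ 2) lie"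
  where "sl2 = \<lparr>lie_space = {M. Determinants.trace M = 0}, bracket = (\<lambda>M N. M ** N - N ** M)\<rparr>"

definition sol2 :: "(complex ^ 2 ^ 2) lie"
  where "sol2 = \<lparr>lie_space = {M. Determinants.trace M = 0 \<and> vec_nth (vec_nth M 2) 1 = 0},
     bracket = (\<lambda>M N. M ** N - N ** M)\<rparr>"

definition abelian_line :: "complex lie"
  where "abelian_line = \<lparr>lie_space = UNIV, bracket = (\<lambda>_ _. 0)\<rparr>"

locale lie_rep =
  fixes L :: "'g::complex_vector lie" and \<theta> :: "'g \<Rightarrow> 'v::complex_vector \<Rightarrow> 'v"
  assumes bilinear_rep: "bilinear_on (lie_space L) UNIV \<theta>"
    and rep_bracket:
      "x \<in> lie_space L \<Longrightarrow> y \<in> lie_space L \<Longrightarrow>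
        \<theta> (bracket L x y) v = \<theta> x (\<theta> y v) - \<theta> y (\<theta> x v)"


section \<open>Flat connections and resonance\<close>

definition tensor_diff ::
    "'a::complex_vector dga \<Rightarrow> 'g::complex_vector lie \<Rightarrow> nat \<Rightarrow> ('a, 'g) tensor \<Rightarrow> ('a, 'g) tensor"
  where "tensor_diff A L i =
    tensor_lift (component A i) (lie_space L) (\<lambda>\<alpha> x. differential A i \<alpha> \<otimes>\<^sub>C x)"

definition tensor_bracket ::
    "'a::complex_vector dga \<Rightarrow> 'g::complex_vector lie \<Rightarrow> nat \<Rightarrow> nat \<Rightarrow>
     ('a, 'g) tensor \<Rightarrow> ('a, 'g) tensor \<Rightarrow> ('a, 'g) tensor"
  where "tensor_bracket A L i j s t =
    tensor_lift (component A i) (lie_space L) (\<lambda>\<alpha> x.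
      tensor_lift (component A j) (lie_space L) (\<lambda>\<beta> y. product A i j \<alpha> \<beta> \<otimes>\<^sub>C bracket L x y) t) s"

definition flat_connections :: "'a::complex_vector dga \<Rightarrow> 'g::complex_vector lie \<Rightarrow> ('a, 'g) tensor set"
  where "flat_connections A L =
    {\<omega> \<in> tensor_space (component A 1) (lie_space L).
      tensor_diff A L 1 \<omega> + (1/2) *\<^sub>C tensor_bracket A L 1 1 \<omega> \<omega> = 0}"

definition rank_one_flat :: "'a::complex_vector dga \<Rightarrow> 'g::complex_vector lie \<Rightarrow> ('a, 'g) tensor set"
  where "rank_one_flat A L =
    {\<eta> \<otimes>\<^sub>C g | \<eta> g. \<eta> \<in> component A 1 \<and> differential A 1 \<eta> = 0 \<and> g \<in> lie_space L}"

definition rank_one_singular ::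
    "'a::complex_vector dga \<Rightarrow> 'g::complex_vector lie \<Rightarrow> ('g \<Rightarrow> 'v::complex_vector \<Rightarrow> 'v) \<Rightarrow> ('a, 'g) tensor set"
  where "rank_one_singular A L \<theta> =
    {\<eta> \<otimes>\<^sub>C g | \<eta> g. \<eta> \<in> component A 1 \<and> differential A 1 \<eta> = 0 \<and> g \<in> lie_space L \<and> endo_det (\<theta> g) = 0}"

definition twisted_diff ::
    "'a::complex_vector dga \<Rightarrow> 'g::complex_vector lie \<Rightarrow> ('g \<Rightarrow> 'v::complex_vector \<Rightarrow> 'v) \<Rightarrow>
     ('a, 'g) tensor \<Rightarrow> nat \<Rightarrow> ('a, 'v) tensor \<Rightarrow> ('a, 'v) tensor"
  where "twisted_diff A L \<theta> \<omega> i =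
    tensor_lift (component A i) UNIV (\<lambda>\<alpha> v.
      differential A i \<alpha> \<otimes>\<^sub>C v +
      tensor_lift (component A 1) (lie_space L) (\<lambda>\<eta> g. product A 1 i \<eta> \<alpha> \<otimes>\<^sub>C \<theta> g v) \<omega>)"

definition twisted_cocycles ::
    "'a::complex_vector dga \<Rightarrow> 'g::complex_vector lie \<Rightarrow> ('g \<Rightarrow> 'v::complex_vector \<Rightarrow> 'v) \<Rightarrow>
     ('a, 'g) tensor \<Rightarrow> nat \<Rightarrow> ('a, 'v) tensor set"
  where "twisted_cocycles A L \<theta> \<omega> i =
    {t \<in> tensor_space (component A i) UNIV. twisted_diff A L \<theta> \<omega> i t = 0}"

definition twisted_coboundaries ::
    "'a::complex_vector dga \<Rightarrow> 'g::complex_vector lie \<Rightarrow> ('g \<Rightarrow> 'v::complex_vector \<Rightarrow> 'v) \<Rightarrow>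
     ('a, 'g) tensor \<Rightarrow> nat \<Rightarrow> ('a, 'v) tensor set"
  where "twisted_coboundaries A L \<theta> \<omega> i =
    (case i of 0 \<Rightarrow> {0} | Suc j \<Rightarrow> twisted_diff A L \<theta> \<omega> j ` tensor_space (component A j) UNIV)"

definition resonance ::
    "nat \<Rightarrow> nat \<Rightarrow> 'a::complex_vector dga \<Rightarrow> 'g::complex_vector lie \<Rightarrow>
     ('g \<Rightarrow> 'v::complex_vector \<Rightarrow> 'v) \<Rightarrow> ('a, 'g) tensor set"
  where "resonance i r A L \<theta> =
    {\<omega> \<in> flat_connections A L.
      quotient_dim (twisted_cocycles A L \<theta> \<omega> i) (twisted_coboundaries A L \<theta> \<omega> i) \<ge> enat r}"

text \<open>For the Lie algebra \<open>\<complex>\<close> acting on itself by the identity representation, as a subset of the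
  degree 1 component via \<open>\<alpha> \<mapsto> \<alpha> \<otimes>\<^sub>C 1\<close>.\<close>

definition rank_one_resonance :: "nat \<Rightarrow> nat \<Rightarrow> 'a::complex_vector dga \<Rightarrow> 'a set"
  where "rank_one_resonance i r A =
    {\<alpha> \<in> component A 1. \<alpha> \<otimes>\<^sub>C (1::complex) \<in> resonance i r A abelian_line (\<lambda>c v. c * v)}"


section \<open>Well-definedness checks\<close>

lemma cdga_sub_dga:
  assumes A: "cdga A" and C: "csubspace C" "C \<subseteq> component A 1"
  shows "cdga (sub_dga A C)"
proof -
  let ?B = "sub_dga A C"
  interpret cdga A by (rule A)
  have sub: "csubspace (component A i)" for i
    by (rule subspace_component)
  have unit: "unity A \<in> component A 0"
    by (rule unity_closed)
  have le: "component ?B i \<subseteq> component A i" for i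
  proof -
    have "cspan {unity A} \<subseteq> component A 0"
      using unit sub[of 0] by (intro complex_vector.span_minimal) auto
    then show ?thesis
      using C(2) complex_vector.subspace_0[OF sub[of i]] by (auto simp: sub_dga_def)
  qed
  have subB: "csubspace (component ?B i)" for i
    using sub C(1) by (auto simp: sub_dga_def)
  have prodA: "product A i j x y \<in> component A (i + j)"
    if "x \<in> component A i" "y \<in> component A j" for i j x y
    using that by (rule product_closed)
  have bil: "bilinear_on (component A i) (component A j) (product A i j)" for i j
    by (rule bilinear_product)
  have lin: "linear_on (component A i) (differential A i)" for i
    by (rule linear_differential)
  have dA: "differential A i x \<in> component A (Suc i)" if "x \<in> component A i" for i x
    using that by (rule differential_closed)
  have unitl: "product A 0 i (unity A) x = x" and unitr: "product A i 0 x (unity A) = x"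
    if "x \<in> component A i" for i x
    using that by (auto intro: product_unity_left product_unity_right)
  have prod_span_l: "product A 0 i z x = c *\<^sub>C x" and prod_span_r: "product A i 0 x z = c *\<^sub>C x"
    if "x \<in> component A i" "z = c *\<^sub>C unity A" for i x z c
    using bil[of 0 i] bil[of i 0] that unit unitl[of x i] unitr[of x i]
    unfolding bilinear_on_def linear_on_def by auto
  have leib: "differential A (i + j) (product A i j x y) =
        product A (Suc i) j (differential A i x) y +
        (-1) ^ i *\<^sub>C product A i (Suc j) x (differential A j y)"
    if "x \<in> component A i" "y \<in> component A j" for i j x y
    using that by (rule leibniz)
  have dd: "differential A (Suc i) (differential A i x) = 0" if "x \<in> component A i" for i x
    using that by (rule differential_differential)
  have comm: "product A j i y x = (-1) ^ (i * j) *\<^sub>C product A i j x y"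
    if "x \<in> component A i" "y \<in> component A j" for i j x y
    using that by (rule product_commute)
  have assoc: "product A (i + j) k (product A i j x y) z = product A i (j + k) x (product A j k y z)"
    if "x \<in> component A i" "y \<in> component A j" "z \<in> component A k" for i j k x y z
    using that by (rule product_assoc)
  have d1: "differential A 0 (unity A) = 0"
    using leib[OF unit unit] unitl[OF unit] unitl[OF dA[OF unit]] unitr[OF dA[OF unit]]
    by (simp add: scaleC_one)
  have d_span: "differential A 0 z = 0" if "z = c *\<^sub>C unity A" for z c
    using that lin[of 0] unit d1 unfolding linear_on_def by auto
  have big: "component ?B i = {0}" if "i > 2" for i
    using that by (simp add: sub_dga_def)
  have B0: "component ?B 0 = range (\<lambda>c. c *\<^sub>C unity A)"
    by (simp add: sub_dga_def complex_vector.span_singleton)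
  have B1: "component ?B 1 = C" and B2: "component ?B 2 = component A 2"
    by (simp_all add: sub_dga_def)
  have prodB: "product ?B i j x y = (if i + j \<le> 2 then product A i j x y else 0)" for i j x y
    by (simp add: sub_dga_def truncation2_def)
  have dB: "differential ?B i x = (if Suc i \<le> 2 then differential A i x else 0)" for i x
    by (simp add: sub_dga_def truncation2_def)
  have uB: "unity ?B = unity A"
    by (simp add: sub_dga_def truncation2_def)
  have zeroB: "0 \<in> component ?B i" for i
    by (rule complex_vector.subspace_0[OF subB])
  have prod_in: "product ?B i j x y \<in> component ?B (i + j)"
    if x: "x \<in> component ?B i" and y: "y \<in> component ?B j" for i j x y
  proof (cases "i + j \<le> 2")
    case False
    then show ?thesis by (simp add: prodB zeroB)
  next
    case True
    have xA: "x \<in> component A i" and yA: "y \<in> component A j"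
      using x y le by blast+
    consider "i = 0" | "j = 0" | "i + j = 2" using True by linarith
    then show ?thesis
    proof cases
      case 1
      with x obtain c where "x = c *\<^sub>C unity A" by (auto simp: B0)
      with prod_span_l[OF yA this] 1 True y show ?thesis
        by (simp add: prodB complex_vector.subspace_scale[OF subB])
    next
      case 2
      with y obtain c where "y = c *\<^sub>C unity A" by (auto simp: B0)
      with prod_span_r[OF xA this] 2 True x show ?thesis
        by (simp add: prodB complex_vector.subspace_scale[OF subB])
    next
      case 3
      with prodA[OF xA yA] show ?thesis by (simp add: prodB B2)
    qed
  qed
  have d_in: "differential ?B i x \<in> component ?B (Suc i)" if x: "x \<in> component ?B i" for i x
  proof -
    have xA: "x \<in> component A i" using x le by blast
    consider "i = 0" | "i = 1" | "i > 1" by linarith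
    then show ?thesis
    proof cases
      case 1
      with x obtain c where "x = c *\<^sub>C unity A" by (auto simp: B0)
      from d_span[OF this] 1 show ?thesis by (simp add: dB zeroB)
    next
      case 2
      with dA[OF xA] show ?thesis using B2 by (simp add: dB numeral_2_eq_2)
    next
      case 3
      then show ?thesis by (simp add: dB zeroB)
    qed
  qed
  show ?thesis
    proof
    fix i j k x y z
    show "csubspace (component ?B i)" by (rule subB)
    show "bilinear_on (component ?B i) (component ?B j) (product ?B i j)"
      using bil[of i j] le[of i] le[of j]
      by (auto simp: prodB bilinear_on_def linear_on_def subset_iff)
    show "linear_on (component ?B i) (differential ?B i)"
      using lin[of i] le[of i] by (auto simp: dB linear_on_def subset_iff)
    show "unity ?B \<in> component ?B 0"
      by (simp add: sub_dga_def truncation2_def complex_vector.span_base)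
    assume x: "x \<in> component ?B i"
    then have xA: "x \<in> component A i" using le by blast
    show "product ?B 0 i (unity ?B) x = x" "product ?B i 0 x (unity ?B) = x"
      using x unitl[OF xA] unitr[OF xA] big[of i] by (auto simp: prodB uB not_le)
    show "differential ?B i x \<in> component ?B (Suc i)" by (rule d_in[OF x])
    show "differential ?B (Suc i) (differential ?B i x) = 0"
      using dd[OF xA] by (auto simp: dB)
    assume y: "y \<in> component ?B j"
    then have yA: "y \<in> component A j" using le by blast
    show "product ?B i j x y \<in> component ?B (i + j)" by (rule prod_in[OF x y])
    show "product ?B j i y x = (- 1) ^ (i * j) *\<^sub>C product ?B i j x y"
      using comm[OF xA yA] by (simp add: prodB add.commute[of j i])
    show "differential ?B (i + j) (product ?B i j x y) =
        product ?B (Suc i) j (differential ?B i x) y +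
        (- 1) ^ i *\<^sub>C product ?B i (Suc j) x (differential ?B j y)"
    proof (cases "Suc (i + j) \<le> 2")
      case True
      then show ?thesis using leib[OF xA yA] by (simp add: prodB dB)
    next
      case False
      then show ?thesis by (simp add: prodB dB)
    qed
    assume z: "z \<in> component ?B k"
    then have zA: "z \<in> component A k" using le by blast
    show "product ?B (i + j) k (product ?B i j x y) z = product ?B i (j + k) x (product ?B j k y z)"
    proof (cases "i + j + k \<le> 2")
      case True
      then show ?thesis using assoc[OF xA yA zA] by (simp add: prodB)
    next
      case False
      then show ?thesis by (simp add: prodB)
    qed
  qed
qed

lemma scaleC_vec_nth: "vec_nth (c *\<^sub>C x) i = c *\<^sub>C vec_nth x i"
  by (simp add: scaleC_vec_def)

lemma traceless_scaleC:
  fixes M :: "complex ^ 2 ^ 2"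
  assumes "Determinants.trace M = 0"
  shows "Determinants.trace (c *\<^sub>C M) = 0"
proof -
  have "Determinants.trace (c *\<^sub>C M) = c * Determinants.trace M"
    by (simp add: Determinants.trace_def sum_2 scaleC_vec_nth scaleC_complex_def distrib_left)
  with assms show ?thesis by simp
qed

lemma trace_zero_matrix: "Determinants.trace (0 :: complex ^ 2 ^ 2) = 0"
  by (simp add: Determinants.trace_def)

lemma trace_commutator: "Determinants.trace (M ** N - N ** M) = (0::complex)" for M N :: "complex ^ 2 ^ 2"
  by (simp add: Determinants.trace_def matrix_matrix_mult_def sum_2)

lemma bilinear_commutator: "bilinear_on S T (\<lambda>M N :: complex ^ 2 ^ 2. M ** N - N ** M)"
  by (simp add: bilinear_on_def linear_on_def matrix_matrix_mult_def sum_2 scaleC_vec_nth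
      scaleC_complex_def Finite_Cartesian_Product.vec_eq_iff forall_2 algebra_simps)

lemma jacobi_commutator:
  fixes M N P :: "complex ^ 2 ^ 2"
  shows "(M ** (N ** P - P ** N) - (N ** P - P ** N) ** M) + (N ** (P ** M - M ** P) - (P ** M - M ** P) ** N)
    + (P ** (M ** N - N ** M) - (M ** N - N ** M) ** P) = 0"
  by (simp add: matrix_matrix_mult_def sum_2 Finite_Cartesian_Product.vec_eq_iff forall_2 algebra_simps)

lemma lie_algebra_sl2: "lie_algebra sl2"
  by unfold_locales
    (auto simp: sl2_def complex_vector.subspace_def trace_commutator bilinear_commutator
      jacobi_commutator traceless_scaleC trace_add trace_zero_matrix)

lemma lie_algebra_sol2: "lie_algebra sol2"
proof unfold_locales
  have "vec_nth (vec_nth (M ** N - N ** M) 2) 1 = 0"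
    if "Determinants.trace M = 0" "Determinants.trace N = 0"
      "vec_nth (vec_nth M 2) 1 = 0" "vec_nth (vec_nth N 2) 1 = 0" for M N :: "complex ^ 2 ^ 2"
    using that by (simp add: matrix_matrix_mult_def sum_2)
  then show "bracket sol2 x y \<in> lie_space sol2" if "x \<in> lie_space sol2" "y \<in> lie_space sol2" for x y
    using that by (simp add: sol2_def trace_commutator)
qed (auto simp: sol2_def complex_vector.subspace_def bilinear_commutator
      jacobi_commutator traceless_scaleC trace_add trace_zero_matrix scaleC_vec_nth)

end

theory Submission
  imports Defs
begin

text \<open>
  A connection is a finite sum \<open>\<Sum> \<eta>\<^sub>i \<otimes> g\<^sub>i\<close>, and it is flat iff an expression vanishes that involves
  only the operations on the \<open>\<eta>\<^sub>i\<close> and the \<open>g\<^sub>i\<close>, not the subspaces from which these are taken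
  (\<open>flat_connections_iff_curvature\<close>).  Hence the connections of \<open>A\<^sub>C\<close> are exactly the
  connections of \<open>A\<close> that lie in \<open>C \<otimes> \<gg>\<close> (\<open>flat_connections_sub_dga\<close>), and \<open>C \<otimes> \<gg>\<close> is cut out by
  linear equations; this gives the inclusion and the Zariski-closedness.

  Now let the differential vanish and \<open>A\<^sup>1 \<noteq> 0\<close>.  With \<open>\<omega> = a \<otimes> H + b \<otimes> X + c \<otimes> Y\<close> in the standard basis of
  \<open>sl\<^sub>2\<close> (and \<open>c = 0\<close> for \<open>sol\<^sub>2\<close>), the three components of the curvature are non-zero multiples of
  \<open>ab\<close>, \<open>ac\<close>, \<open>bc\<close>.  So \<open>\<omega>\<close> is flat only if the span \<open>U\<close> of \<open>a, b, c\<close> is isotropic, that is, all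
  products of its elements vanish (\<open>flat_connection_sl2_support\<close>).  If \<open>dim U \<le> 1\<close>, then \<open>\<omega>\<close> is a
  single tensor \<open>\<eta> \<otimes> g\<close>.  Otherwise every \<open>x\<close> in \<open>U\<close> is annihilated by some \<open>y\<close> in \<open>U\<close> outside the line
  of \<open>x\<close>, which says that \<open>x\<close> lies in the rank one resonance variety
  (\<open>rank_one_resonance_iff\<close>); as a vector space over an infinite field is not a finite union of
  proper subspaces, \<open>U\<close> lies in one \<open>C\<close>, and \<open>\<omega>\<close> is a connection of \<open>A\<^sub>C\<close>.

  For the resonance of \<open>\<theta>\<close> the same two cases suffice.
  \<^item> A tensor \<open>\<eta> \<otimes> g\<close> is resonant iff \<open>\<theta> g\<close> is singular or \<open>\<eta>\<close> is resonant in rank one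
    (\<open>resonance_of_rank_one\<close>).  If \<open>\<eta> \<noteq> 0\<close> and \<open>\<theta> g\<close> misses \<open>u\<close>, then \<open>\<eta> \<otimes> u\<close> is a cocycle that does not bound;
    if \<open>\<theta> g\<close> is invertible, it can be cancelled, and the cocycles become \<open>ker (\<eta> \<cdot>) \<otimes> V\<close> and the
    coboundaries \<open>\<complex>\<eta> \<otimes> V\<close>.
  \<^item> If \<open>dim U \<ge> 2\<close>, then \<open>\<omega>\<close> is always resonant (\<open>resonance_of_isotropic\<close>): all of \<open>U \<otimes> V\<close> consists
    of cocycles, and its dimension is at least \<open>2 dim V\<close>, whereas the coboundaries are the image of
    \<open>V\<close>.
\<close>


section \<open>Linear maps and subspaces\<close>

lemma linear_on_UNIV_simps:
  assumes "linear_on UNIV f"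
  shows "f (x + y) = f x + f y" "f (c *\<^sub>C x) = c *\<^sub>C f x" "f 0 = 0" "f (- x) = - f x" "f (x - y) = f x - f y"
proof -
  interpret f: Vector_Spaces.linear scaleC scaleC f
    using assms by (simp add: linear_on_UNIV_iff)
  show "f (x + y) = f x + f y" "f (c *\<^sub>C x) = c *\<^sub>C f x" "f 0 = 0" "f (- x) = - f x" "f (x - y) = f x - f y"
    by (rule f.add f.scale f.zero f.neg f.diff)+
qed

lemma linear_on_UNIV_sum_list:
  assumes "linear_on UNIV f"
  shows "f (\<Sum>(x, y)\<leftarrow>zs. g x y) = (\<Sum>(x, y)\<leftarrow>zs. f (g x y))"
  by (induction zs) (auto simp: linear_on_UNIV_simps[OF assms])

lemma add_self_eq_0_iff:
  fixes x :: "'a::complex_vector"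
  shows "x + x = 0 \<longleftrightarrow> x = 0"
proof -
  have "x + x = 2 *\<^sub>C x"
    by (metis one_add_one scaleC_add_left scaleC_one)
  then show ?thesis by simp
qed

text \<open>Extend a basis of \<open>S\<close> by \<open>x\<close> to an independent set; a linear map may be prescribed on it.\<close>

lemma separating_functional:
  fixes S :: "'a::complex_vector set"
  assumes S: "csubspace S" and x: "x \<notin> S"
  shows "\<exists>\<phi> :: 'a \<Rightarrow> complex. linear_on UNIV \<phi> \<and> \<phi> x = 1 \<and> (\<forall>y\<in>S. \<phi> y = 0)"
proof -
  interpret vector_space_pair "scaleC :: complex \<Rightarrow> 'a \<Rightarrow> 'a" "scaleC :: complex \<Rightarrow> complex \<Rightarrow> complex"
    by unfold_locales
  obtain B where B: "B \<subseteq> S" "\<not> cdependent B" "S \<subseteq> cspan B"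
    using complex_vector.maximal_independent_subset[of S] by blast
  have xB: "x \<notin> cspan B"
    using complex_vector.span_minimal[OF B(1) S] x by blast
  then have "\<not> cdependent (insert x B)"
    using B(2) by (rule complex_vector.independent_insertI)
  then obtain \<phi> :: "'a \<Rightarrow> complex" where \<phi>: "linear_on UNIV \<phi>" "\<forall>y\<in>insert x B. \<phi> y = (if y = x then 1 else 0)"
    using linear_independent_extend[of "insert x B" "\<lambda>y. if y = x then 1 else 0"]
    unfolding linear_on_UNIV_iff cdependent_raw_def by blast
  have B0: "\<phi> y = 0" if "y \<in> B" for y
    using \<phi>(2) that xB complex_vector.span_base by (metis insert_iff)
  have "\<phi> y = 0" if "y \<in> cspan B" for y
    using that
    by (induction rule: complex_vector.span_induct_alt) (auto simp: linear_on_UNIV_simps[OF \<phi>(1)] B0)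
  with \<phi> B(3) show ?thesis by auto
qed

lemma functional_nonzero:
  fixes x :: "'a::complex_vector"
  assumes "x \<noteq> 0"
  shows "\<exists>\<phi> :: 'a \<Rightarrow> complex. linear_on UNIV \<phi> \<and> \<phi> x = 1"
  using separating_functional[of "{0}" x] assms by auto

text \<open>A line \<open>v + c u\<close> has infinitely many points, so if it is covered by finitely many subspaces, two
  of its points lie in the same one, which then contains \<open>u\<close>.  This is applied to a point \<open>u\<close> of \<open>U\<close>
  that only the member \<open>D\<close> of the family covers and a point \<open>v\<close> of \<open>U\<close> outside \<open>D\<close>: the line avoids \<open>D\<close>.\<close>

lemma subspace_covered_by_finite_union:
  fixes U :: "'a::complex_vector set"
  assumes "finite F" and "csubspace U" and "\<forall>C\<in>F. csubspace C" and "U \<subseteq> \<Union>F"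
  shows "\<exists>C\<in>F. U \<subseteq> C"
  using assms(1,3,4)
proof (induction F rule: finite_induct)
  case empty
  then show ?case using complex_vector.subspace_0[OF assms(2)] by auto
next
  case (insert D F)
  show ?case
  proof (cases "U \<subseteq> \<Union>F \<or> U \<subseteq> D")
    case True
    with insert show ?thesis by blast
  next
    case False
    then obtain u v where u: "u \<in> U" "u \<notin> \<Union>F" and v: "v \<in> U" "v \<notin> D" by blast
    from u insert.prems have uD: "u \<in> D" by blast
    have D: "csubspace D" using insert.prems by blast
    have "v + c *\<^sub>C u \<notin> D" for c
    proof
      assume "v + c *\<^sub>C u \<in> D"
      then have "(v + c *\<^sub>C u) - c *\<^sub>C u \<in> D"
        by (intro complex_vector.subspace_diff[OF D] complex_vector.subspace_scale[OF D] uD)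
      with v show False by simp
    qed
    moreover have "v + c *\<^sub>C u \<in> U" for c
      using u v assms(2) by (simp add: complex_vector.subspace_add complex_vector.subspace_scale)
    ultimately have "\<forall>c. \<exists>C\<in>F. v + c *\<^sub>C u \<in> C"
      using insert.prems by blast
    then obtain G where G: "G c \<in> F" "v + c *\<^sub>C u \<in> G c" for c by metis
    have "\<not> inj G"
      using G(1) insert.hyps(1) infinite_UNIV_char_0[where 'a = complex]
      by (meson finite_imageD finite_subset image_subsetI)
    then obtain c c' where c: "c \<noteq> c'" "G c = G c'" by (auto simp: inj_def)
    have GS: "csubspace (G c)" using insert.prems G(1) by blast
    have "(v + c *\<^sub>C u) - (v + c' *\<^sub>C u) \<in> G c"
      using G(2)[of c] G(2)[of c'] c(2) by (intro complex_vector.subspace_diff[OF GS]) auto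
    then have "(c - c') *\<^sub>C u \<in> G c"
      by (simp add: complex_vector.scale_left_diff_distrib)
    then have "(1 / (c - c')) *\<^sub>C (c - c') *\<^sub>C u \<in> G c"
      by (rule complex_vector.subspace_scale[OF GS])
    with c(1) have "u \<in> G c" by (simp add: scaleC_one)
    with G(1) u(2) show ?thesis by blast
  qed
qed


section \<open>Determinants of endomorphisms\<close>

lemma fin_dim_UNIV_basis:
  assumes "fin_dim (UNIV :: 'v::complex_vector set)"
  obtains B :: "'v::complex_vector set" where "finite_dimensional_vector_space scaleC B"
proof -
  obtain B0 :: "'v set" where B0: "finite B0" "cspan B0 = UNIV"
    using assms unfolding fin_dim_def by metis
  obtain B where B: "B \<subseteq> B0" "\<not> cdependent B" "B0 \<subseteq> cspan B"
    using complex_vector.maximal_independent_subset[of B0] by blast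
  have "cspan B = UNIV"
    using B0(2) complex_vector.span_minimal[OF B(3) complex_vector.subspace_span] by auto
  then have "finite_dimensional_vector_space scaleC B"
    using B B0(1) finite_subset
    by unfold_locales (auto simp: cspan_raw_def[symmetric] cdependent_raw_def[symmetric])
  then show thesis by (rule that)
qed

lemma endo_surj_iff_inj:
  fixes f :: "'v::complex_vector \<Rightarrow> 'v"
  assumes "fin_dim (UNIV :: 'v set)" and f: "linear_on UNIV f"
  shows "surj f \<longleftrightarrow> inj f"
proof -
  obtain B :: "'v set" where "finite_dimensional_vector_space scaleC B"
    using fin_dim_UNIV_basis[OF assms(1)] .
  then interpret fd: finite_dimensional_vector_space scaleC B .
  show ?thesis
    using fd.linear_inj_imp_surj[of f] fd.linear_surj_imp_inj[of f] f
    unfolding linear_on_UNIV_iff by blast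
qed

text \<open>In the basis chosen by the definition of the determinant, \<open>f\<close> acts on coordinates as the matrix
  \<open>M\<close>; so a non-zero vector in the kernel of \<open>M\<close> is the same as one in the kernel of \<open>f\<close>.\<close>

lemma endo_det_eq_0_iff:
  fixes f :: "'v::complex_vector \<Rightarrow> 'v"
  assumes "fin_dim (UNIV :: 'v set)" and f: "linear_on UNIV f"
  shows "endo_det f = 0 \<longleftrightarrow> \<not> inj f"
proof -
  obtain B :: "'v set" where B: "finite_dimensional_vector_space scaleC B"
    using fin_dim_UNIV_basis[OF assms(1)] .
  then interpret fd: finite_dimensional_vector_space scaleC B .
  obtain bs0 where "set bs0 = B" "distinct bs0"
    using finite_distinct_list[OF fd.finite_Basis] by blast
  then have "\<exists>bs. distinct bs \<and> \<not> cdependent (set bs) \<and> cspan (set bs) = (UNIV :: 'v set)"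
    using fd.independent_Basis fd.span_Basis unfolding cdependent_raw_def cspan_raw_def by blast
  from someI_ex[OF this] obtain bs :: "'v list" where
    bs: "distinct bs" "\<not> cdependent (set bs)" "cspan (set bs) = UNIV"
    and bs_eq: "bs = (SOME bs. distinct bs \<and> \<not> cdependent (set bs) \<and> cspan (set bs) = UNIV)"
    by blast
  define n where "n = length bs"
  define M where "M = Matrix.mat n n (\<lambda>(i, j). crepresentation (set bs) (f (bs ! j)) (bs ! i))"
  have M: "M \<in> carrier_mat n n" by (simp add: M_def)
  have det: "endo_det f = Determinant.det M"
    unfolding endo_det_def bs_eq[symmetric] M_def n_def Let_def ..
  have bij: "bij_betw (\<lambda>i. bs ! i) {..<n} (set bs)"
    unfolding n_def using bs(1) by (rule bij_betw_nth) auto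
  have rep: "x = (\<Sum>i<n. crepresentation (set bs) x (bs ! i) *\<^sub>C bs ! i)" for x
  proof -
    have "(\<Sum>b\<in>set bs. crepresentation (set bs) x b *\<^sub>C b) = x"
      by (rule complex_vector.sum_representation_eq) (use bs in auto)
    moreover have "(\<Sum>i<n. crepresentation (set bs) x (bs ! i) *\<^sub>C bs ! i)
        = (\<Sum>b\<in>set bs. crepresentation (set bs) x b *\<^sub>C b)"
      by (rule sum.reindex_bij_betw[OF bij])
    ultimately show ?thesis by simp
  qed
  \<comment> \<open>Independence of the set of basis vectors, transported to coordinates indexed by position.\<close>
  have indep: "\<forall>i<n. c i = 0" if "(\<Sum>i<n. c i *\<^sub>C bs ! i) = 0" for c
  proof -
    define d where "d b = c (the_inv_into {..<n} (\<lambda>i. bs ! i) b)" for b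
    have d: "d (bs ! i) = c i" if "i < n" for i
      using that bij by (simp add: d_def the_inv_into_f_f bij_betw_def)
    have "(\<Sum>b\<in>set bs. d b *\<^sub>C b) = (\<Sum>i<n. d (bs ! i) *\<^sub>C bs ! i)"
      by (rule sum.reindex_bij_betw[OF bij, symmetric])
    also have "\<dots> = 0" using that d by simp
    finally have "\<forall>b\<in>set bs. d b = 0"
      using complex_vector.independentD[OF bs(2), of "set bs" d] by auto
    then show ?thesis using d by (metis n_def nth_mem)
  qed
  have Mv: "vec_index (M *\<^sub>v Matrix.vec n c) i = (\<Sum>j<n. M $$ (i, j) * c j)" if "i < n" for i c
    using that carrier_matD[OF M] by (simp add: scalar_prod_def lessThan_atLeast0)
  \<comment> \<open>The defining property of the matrix of \<open>f\<close>.\<close>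
  have f_sum: "f (\<Sum>j<n. c j *\<^sub>C bs ! j) = (\<Sum>i<n. vec_index (M *\<^sub>v Matrix.vec n c) i *\<^sub>C bs ! i)" for c
  proof -
    have "f (\<Sum>j<n. c j *\<^sub>C bs ! j) = (\<Sum>j<n. c j *\<^sub>C f (bs ! j))"
      by (induction n) (simp_all add: linear_on_UNIV_simps[OF f])
    also have "\<dots> = (\<Sum>j<n. c j *\<^sub>C (\<Sum>i<n. M $$ (i, j) *\<^sub>C bs ! i))"
      by (intro sum.cong refl arg_cong2[of _ _ _ _ scaleC]) (subst rep, simp add: M_def)
    also have "\<dots> = (\<Sum>i<n. \<Sum>j<n. (M $$ (i, j) * c j) *\<^sub>C bs ! i)"
      by (subst sum.swap) (simp add: complex_vector.scale_sum_right scaleC_scaleC mult.commute)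
    also have "\<dots> = (\<Sum>i<n. vec_index (M *\<^sub>v Matrix.vec n c) i *\<^sub>C bs ! i)"
      by (intro sum.cong refl) (simp add: Mv lessThan_atLeast0 complex_vector.scale_sum_left)
    finally show ?thesis .
  qed
  have "Determinant.det M = 0 \<longleftrightarrow> (\<exists>v\<in>carrier_vec n. v \<noteq> 0\<^sub>v n \<and> M *\<^sub>v v = 0\<^sub>v n)"
    using det_0_iff_vec_prod_zero[OF M] by blast
  also have "\<dots> \<longleftrightarrow> (\<exists>x. x \<noteq> 0 \<and> f x = 0)"
  proof
    assume "\<exists>v\<in>carrier_vec n. v \<noteq> 0\<^sub>v n \<and> M *\<^sub>v v = 0\<^sub>v n"
    then obtain v where v: "v \<in> carrier_vec n" "v \<noteq> 0\<^sub>v n" "M *\<^sub>v v = 0\<^sub>v n" by blast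
    let ?x = "\<Sum>j<n. (vec_index v j) *\<^sub>C bs ! j"
    have "Matrix.vec n (\<lambda>j. vec_index v j) = v" using v(1) by auto
    then have "f ?x = (\<Sum>i<n. vec_index (0\<^sub>v n) i *\<^sub>C bs ! i)"
      using f_sum[of "\<lambda>j. vec_index v j"] v(3) by metis
    also have "\<dots> = 0" by (intro sum.neutral) simp
    finally have "f ?x = 0" .
    moreover have "?x \<noteq> 0"
    proof
      assume "?x = 0"
      from indep[OF this] v(1) have "v = 0\<^sub>v n"
        by (intro eq_vecI) simp_all
      with v(2) show False by contradiction
    qed
    ultimately show "\<exists>x. x \<noteq> 0 \<and> f x = 0" by blast
  next
    assume "\<exists>x. x \<noteq> 0 \<and> f x = 0"
    then obtain x where x: "x \<noteq> 0" "f x = 0" by blast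
    define c where "c j = crepresentation (set bs) x (bs ! j)" for j
    have xc: "x = (\<Sum>j<n. c j *\<^sub>C bs ! j)" unfolding c_def by (rule rep)
    have "(\<Sum>i<n. vec_index (M *\<^sub>v Matrix.vec n c) i *\<^sub>C bs ! i) = 0"
      using f_sum[of c] x(2) xc by simp
    from indep[OF this] have "M *\<^sub>v Matrix.vec n c = 0\<^sub>v n"
      using carrier_matD[OF M]
      by (intro eq_vecI) (simp_all del: index_mult_mat_vec)
    moreover have "Matrix.vec n c \<noteq> 0\<^sub>v n"
    proof
      assume "Matrix.vec n c = 0\<^sub>v n"
      then have "c j = 0" if "j < n" for j
        using that by (metis index_vec index_zero_vec(1))
      with x(1) xc show False by simp
    qed
    ultimately show "\<exists>v\<in>carrier_vec n. v \<noteq> 0\<^sub>v n \<and> M *\<^sub>v v = 0\<^sub>v n" by auto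
  qed
  also have "\<dots> \<longleftrightarrow> \<not> inj f"
  proof
    assume "\<exists>x. x \<noteq> 0 \<and> f x = 0"
    then show "\<not> inj f" using linear_on_UNIV_simps(3)[OF f] by (metis injD)
  next
    assume "\<not> inj f"
    then obtain x y where "x \<noteq> y" "f x = f y" by (auto simp: inj_def)
    then show "\<exists>x. x \<noteq> 0 \<and> f x = 0"
      using linear_on_UNIV_simps(5)[OF f] by (intro exI[of _ "x - y"]) simp
  qed
  finally show ?thesis unfolding det .
qed


section \<open>Tensor products\<close>

lemma tens_zero [simp]: "0 \<otimes>\<^sub>C y = 0" "x \<otimes>\<^sub>C 0 = 0"
  using tens_scaleC_left[of 0 0 y] tens_scaleC_right[of x 0 0] by simp_all

lemma linear_on_sum_list:
  assumes "\<forall>z\<in>set zs. linear_on S (\<lambda>x. f x z)"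
  shows "linear_on S (\<lambda>x. \<Sum>z\<leftarrow>zs. f x z)"
  using assms
proof (induction zs)
  case Nil
  then show ?case by (simp add: linear_on_def)
next
  case (Cons z zs)
  then have "linear_on S (\<lambda>x. \<Sum>z\<leftarrow>zs. f x z)" "linear_on S (\<lambda>x. f x z)" by auto
  then show ?case by (auto simp: linear_on_def scaleC_add_right algebra_simps)
qed

lemma linear_on_cong:
  assumes "csubspace S" "\<And>x. x \<in> S \<Longrightarrow> f x = g x"
  shows "linear_on S f \<longleftrightarrow> linear_on S g"
  using assms by (simp add: linear_on_def complex_vector.subspace_add complex_vector.subspace_scale)

text \<open>The lift is specified only on the tensor space of \<open>S\<close> and \<open>T\<close>.  Precomposing with projections to \<open>S\<close> and
  \<open>T\<close> makes \<open>f\<close> bilinear everywhere, and the universal property then supplies a globally linear map,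
  to which additivity applies without side conditions.\<close>

lemma tensor_lift_linear:
  fixes f :: "'a::complex_vector \<Rightarrow> 'b::complex_vector \<Rightarrow> 'c::complex_vector"
  assumes S: "csubspace S" and T: "csubspace T" and f: "bilinear_on S T f"
  shows "\<exists>F. linear_on UNIV F \<and> (\<forall>t\<in>tensor_space S T. tensor_lift S T f t = F t)
    \<and> (\<forall>x\<in>S. \<forall>y\<in>T. F (x \<otimes>\<^sub>C y) = f x y)"
proof -
  obtain p where p: "linear_on UNIV p" "range p \<subseteq> S" "\<And>x. x \<in> S \<Longrightarrow> p x = x"
    using linear_projection[OF S] by blast
  obtain q where q: "linear_on UNIV q" "range q \<subseteq> T" "\<And>x. x \<in> T \<Longrightarrow> q x = x"
    using linear_projection[OF T] by blast
  have pS: "p x \<in> S" and qT: "q y \<in> T" for x y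
    using p(2) q(2) by auto
  have "bilinear_on UNIV UNIV (\<lambda>x y. f (p x) (q y))"
    using f p(1) q(1) pS qT by (simp add: bilinear_on_def linear_on_def)
  from tensor_universal_property[OF this]
  obtain F where F: "linear_on UNIV F" "\<And>x y. F (x \<otimes>\<^sub>C y) = f (p x) (q y)" by blast
  have "tensor_lift S T f t = F t" if t: "t \<in> tensor_space S T" for t
  proof -
    obtain zs where zs: "set zs \<subseteq> S \<times> T" "t = (\<Sum>(x, y)\<leftarrow>zs. x \<otimes>\<^sub>C y)"
      using tensor_space_sum_list[OF S t] by blast
    have "tensor_lift S T f t = (\<Sum>(x, y)\<leftarrow>zs. f x y)"
      unfolding zs(2) by (rule tensor_lift_sum_list[OF S T f zs(1)])
    also have "\<dots> = (\<Sum>(x, y)\<leftarrow>zs. F (x \<otimes>\<^sub>C y))"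
      using zs(1) by (intro arg_cong[of _ _ sum_list] map_cong) (auto simp: F(2) p(3) q(3))
    also have "\<dots> = F t"
      unfolding zs(2) by (simp add: linear_on_UNIV_sum_list[OF F(1)])
    finally show ?thesis .
  qed
  then show ?thesis using F p(3) q(3) by auto
qed

lemma tens_in_tensor_space: "x \<in> S \<Longrightarrow> y \<in> T \<Longrightarrow> x \<otimes>\<^sub>C y \<in> tensor_space S T"
  unfolding tensor_space_def by (rule complex_vector.span_base) blast

lemma subspace_tensor_space: "csubspace (tensor_space S T)"
  unfolding tensor_space_def by (rule complex_vector.subspace_span)

lemma sum_list_in_tensor_space:
  "set zs \<subseteq> S \<times> T \<Longrightarrow> (\<Sum>(x, y)\<leftarrow>zs. x \<otimes>\<^sub>C y) \<in> tensor_space S T"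
  by (induction zs) (auto intro: complex_vector.subspace_0 complex_vector.subspace_add
      subspace_tensor_space tens_in_tensor_space)

lemma tensor_space_mono: "S \<subseteq> S' \<Longrightarrow> T \<subseteq> T' \<Longrightarrow> tensor_space S T \<subseteq> tensor_space S' T'"
  unfolding tensor_space_def by (rule complex_vector.span_mono) blast

text \<open>Contractions with functionals stand in for coordinates: they are how tensors are compared
  below.\<close>

lemma contract_right:
  fixes \<phi> :: "'b::complex_vector \<Rightarrow> complex"
  assumes "linear_on UNIV \<phi>"
  shows "\<exists>F. linear_on UNIV F \<and> (\<forall>(x :: 'a::complex_vector) y. F (x \<otimes>\<^sub>C y) = \<phi> y *\<^sub>C x)"
  by (rule tensor_universal_property)
    (simp add: bilinear_on_def linear_on_def linear_on_UNIV_simps[OF assms] scaleC_add_left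
      scaleC_add_right scaleC_scaleC scaleC_complex_def mult.commute)

lemma contract_left:
  fixes \<phi> :: "'a::complex_vector \<Rightarrow> complex"
  assumes "linear_on UNIV \<phi>"
  shows "\<exists>F. linear_on UNIV F \<and> (\<forall>x (y :: 'b::complex_vector). F (x \<otimes>\<^sub>C y) = \<phi> x *\<^sub>C y)"
  by (rule tensor_universal_property)
    (simp add: bilinear_on_def linear_on_def linear_on_UNIV_simps[OF assms] scaleC_add_left
      scaleC_add_right scaleC_scaleC scaleC_complex_def mult.commute)

lemma tens_eq_0_iff: "x \<otimes>\<^sub>C y = 0 \<longleftrightarrow> x = 0 \<or> y = 0"
proof
  assume xy: "x \<otimes>\<^sub>C y = 0"
  show "x = 0 \<or> y = 0"
  proof (rule disjCI)
    assume "y \<noteq> 0"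
    then obtain \<phi> where \<phi>: "linear_on UNIV \<phi>" "\<phi> y = (1::complex)"
      using functional_nonzero by blast
    from contract_right[OF \<phi>(1)] obtain F where
      F: "linear_on UNIV F" "F (x \<otimes>\<^sub>C y) = \<phi> y *\<^sub>C x" by blast
    have "x = F (x \<otimes>\<^sub>C y)" by (simp add: F(2) \<phi>(2) scaleC_one)
    also have "\<dots> = 0" unfolding xy by (rule linear_on_UNIV_simps(3)[OF F(1)])
    finally show "x = 0" .
  qed
qed auto

lemma contraction_in_subspace:
  assumes S: "csubspace S" and T: "csubspace T" and R: "csubspace R" and F: "linear_on UNIV F"
    and "\<And>x y. x \<in> S \<Longrightarrow> y \<in> T \<Longrightarrow> F (x \<otimes>\<^sub>C y) \<in> R" and t: "t \<in> tensor_space S T"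
  shows "F t \<in> R"
proof -
  obtain zs where zs: "set zs \<subseteq> S \<times> T" "t = (\<Sum>(x, y)\<leftarrow>zs. x \<otimes>\<^sub>C y)"
    using tensor_space_sum_list[OF S t] by blast
  have "(\<Sum>(x, y)\<leftarrow>zs. F (x \<otimes>\<^sub>C y)) \<in> R"
    using zs(1) by (induction zs) (auto intro: complex_vector.subspace_0 complex_vector.subspace_add R assms)
  then show ?thesis unfolding zs(2) by (simp add: linear_on_UNIV_sum_list[OF F])
qed

lemma tensor_space_line:
  assumes T: "csubspace T" and t: "t \<in> tensor_space (cspan {x}) T"
  shows "\<exists>y\<in>T. t = x \<otimes>\<^sub>C y"
proof -
  obtain zs where zs: "set zs \<subseteq> cspan {x} \<times> T" "t = (\<Sum>(x, y)\<leftarrow>zs. x \<otimes>\<^sub>C y)"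
    using tensor_space_sum_list[OF complex_vector.subspace_span t] by blast
  have "\<exists>y\<in>T. (\<Sum>(x, y)\<leftarrow>zs. x \<otimes>\<^sub>C y) = x \<otimes>\<^sub>C y"
    using zs(1)
  proof (induction zs)
    case Nil
    show ?case by (rule bexI[of _ 0]) (auto intro: complex_vector.subspace_0 T)
  next
    case (Cons z zs)
    then obtain y where y: "y \<in> T" "(\<Sum>(x, y)\<leftarrow>zs. x \<otimes>\<^sub>C y) = x \<otimes>\<^sub>C y" by auto
    obtain c w where z: "z = (c *\<^sub>C x, w)" "w \<in> T"
      using Cons.prems by (cases z) (auto simp: complex_vector.span_singleton)
    have "(\<Sum>(x, y)\<leftarrow>z # zs. x \<otimes>\<^sub>C y) = x \<otimes>\<^sub>C (c *\<^sub>C w + y)"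
      by (simp add: y(2) z(1) tens_add_right tens_scaleC_left tens_scaleC_right)
    moreover have "c *\<^sub>C w + y \<in> T"
      by (intro complex_vector.subspace_add complex_vector.subspace_scale T z(2) y(1))
    ultimately show ?case by blast
  qed
  with zs(2) show ?thesis by simp
qed

text \<open>For a projection \<open>p\<close> onto \<open>S\<close>, a tensor lies in the tensor space of \<open>S\<close> and \<open>T\<close> iff
  \<open>p \<otimes> id\<close> fixes it, and a vector (here the tensor minus its image) vanishes iff all functionals
  vanish on it.\<close>

lemma tensor_space_cut_out_by_functionals:
  fixes S :: "'a::complex_vector set" and T :: "'b::complex_vector set"
  assumes S: "csubspace S"
  shows "\<exists>P. (\<forall>p\<in>P. linear_on UNIV (p :: ('a, 'b) tensor \<Rightarrow> complex)) \<and>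
    (\<forall>S'. csubspace S' \<and> S \<subseteq> S' \<longrightarrow> tensor_space S T = {t \<in> tensor_space S' T. \<forall>p\<in>P. p t = 0})"
proof -
  obtain p where p: "linear_on UNIV p" "range p \<subseteq> S" "\<And>x. x \<in> S \<Longrightarrow> p x = x"
    using linear_projection[OF S] by blast
  have "bilinear_on UNIV UNIV (\<lambda>x y. p x \<otimes>\<^sub>C (y :: 'b))"
    by (simp add: bilinear_on_def linear_on_def linear_on_UNIV_simps[OF p(1)] tens_add_left
        tens_add_right tens_scaleC_left tens_scaleC_right)
  from tensor_universal_property[OF this] obtain F where
    F: "linear_on UNIV F" "\<And>x (y :: 'b). F (x \<otimes>\<^sub>C y) = p x \<otimes>\<^sub>C y" by blast
  let ?P = "{\<lambda>t. \<phi> (t - F t) | \<phi> :: ('a, 'b) tensor \<Rightarrow> complex. linear_on UNIV \<phi>}"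
  have lin: "linear_on UNIV q" if q: "q \<in> ?P" for q
  proof -
    obtain \<phi> :: "('a, 'b) tensor \<Rightarrow> complex" where \<phi>: "linear_on UNIV \<phi>" "q = (\<lambda>t. \<phi> (t - F t))"
      using q by blast
    show ?thesis
      unfolding \<phi>(2) by (simp add: linear_on_def linear_on_UNIV_simps[OF F(1)]
        linear_on_UNIV_simps[OF \<phi>(1)] complex_vector.scale_right_diff_distrib)
  qed
  \<comment> \<open>\<open>F\<close> is \<open>p \<otimes> id\<close>.\<close>
  have fixed: "(\<forall>q\<in>?P. q t = 0) \<longleftrightarrow> F t = t" for t
  proof
    assume *: "\<forall>q\<in>?P. q t = 0"
    show "F t = t"
    proof (rule ccontr)
      assume "F t \<noteq> t"
      then obtain \<phi> where "linear_on UNIV \<phi>" "\<phi> (t - F t) = (1::complex)"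
        using functional_nonzero[of "t - F t"] by auto
      with * show False by auto
    qed
  qed (auto dest: linear_on_UNIV_simps(3))
  have "tensor_space S T = {t \<in> tensor_space S' T. F t = t}" if S': "csubspace S'" "S \<subseteq> S'" for S'
  proof (intro equalityI subsetI CollectI conjI)
    fix t assume t: "t \<in> tensor_space S T"
    then show "t \<in> tensor_space S' T" using tensor_space_mono[OF S'(2)] by blast
    obtain zs where zs: "set zs \<subseteq> S \<times> T" "t = (\<Sum>(x, y)\<leftarrow>zs. x \<otimes>\<^sub>C y)"
      using tensor_space_sum_list[OF S t] by blast
    then show "F t = t"
      unfolding zs(2) linear_on_UNIV_sum_list[OF F(1)]
      by (intro arg_cong[of _ _ sum_list] map_cong) (auto simp: F(2) p(3))
  next
    fix t assume t: "t \<in> {t \<in> tensor_space S' T. F t = t}"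
    then obtain zs where zs: "set zs \<subseteq> S' \<times> T" "t = (\<Sum>(x, y)\<leftarrow>zs. x \<otimes>\<^sub>C y)"
      using tensor_space_sum_list[OF S'(1)] by blast
    have "t = (\<Sum>(x, y)\<leftarrow>zs. p x \<otimes>\<^sub>C y)"
      using t unfolding zs(2) by (simp add: linear_on_UNIV_sum_list[OF F(1)] F(2))
    also have "\<dots> = (\<Sum>(x, y)\<leftarrow>map (\<lambda>(x, y). (p x, y)) zs. x \<otimes>\<^sub>C y)"
      by (simp add: o_def case_prod_unfold)
    also have "\<dots> \<in> tensor_space S T"
      using zs(1) p(2) by (intro sum_list_in_tensor_space) auto
    finally show "t \<in> tensor_space S T" .
  qed
  then show ?thesis using lin fixed by (intro exI[of _ ?P]) simp
qed

lemma tens_linear: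
  "linear_on UNIV (\<lambda>x. x \<otimes>\<^sub>C y)" "linear_on UNIV (\<lambda>y. x \<otimes>\<^sub>C y)"
  by (simp_all add: linear_on_def tens_add_left tens_add_right tens_scaleC_left tens_scaleC_right)

lemma bilinear_on_tens:
  assumes "linear_on S f" and "linear_on T g"
  shows "bilinear_on S T (\<lambda>x y. f x \<otimes>\<^sub>C g y)"
  using assms by (auto simp: bilinear_on_def linear_on_def tens_add_left tens_add_right
      tens_scaleC_left tens_scaleC_right)

lemma linear_on_id: "linear_on S (\<lambda>x. x)"
  by (simp add: linear_on_def)

lemma linear_on_add:
  assumes "linear_on S f" and "linear_on S g"
  shows "linear_on S (\<lambda>x. f x + g x)"
  using assms by (auto simp: linear_on_def scaleC_add_right algebra_simps)

lemma bilinear_on_add: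
  assumes "bilinear_on S T f" and "bilinear_on S T g"
  shows "bilinear_on S T (\<lambda>x y. f x y + g x y)"
  using assms by (auto simp: bilinear_on_def intro!: linear_on_add)

lemma bilinear_on_sum_list:
  assumes "\<And>u v. (u, v) \<in> set zs \<Longrightarrow> bilinear_on S T (\<lambda>x y. f u v x y)"
  shows "bilinear_on S T (\<lambda>x y. \<Sum>(u, v)\<leftarrow>zs. f u v x y)"
  using assms unfolding bilinear_on_def
  by (auto intro!: linear_on_sum_list simp: case_prod_unfold)

lemma bilinear_on_cong:
  assumes "csubspace S" and "csubspace T" and "\<And>x y. x \<in> S \<Longrightarrow> y \<in> T \<Longrightarrow> f x y = g x y"
    and "bilinear_on S T g"
  shows "bilinear_on S T f"
  unfolding bilinear_on_def
proof (intro conjI ballI)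
  show "linear_on S (\<lambda>x. f x y)" if "y \<in> T" for y
    using assms(3,4) that linear_on_cong[OF assms(1), of "\<lambda>x. f x y" "\<lambda>x. g x y"]
    unfolding bilinear_on_def by blast
  show "linear_on T (f x)" if "x \<in> S" for x
    using assms(3,4) that linear_on_cong[OF assms(2), of "f x" "g x"]
    unfolding bilinear_on_def by blast
qed

text \<open>For nested lifts: the inner lift equals an explicit bilinear expression on the carriers only, and
  no more than that is required.\<close>

lemma tensor_lift_sum_list_cong:
  assumes S: "csubspace S" and T: "csubspace T" and eq: "\<And>x y. x \<in> S \<Longrightarrow> y \<in> T \<Longrightarrow> f x y = g x y"
    and g: "bilinear_on S T g" and zs: "set zs \<subseteq> S \<times> T"
  shows "tensor_lift S T f (\<Sum>(x, y)\<leftarrow>zs. x \<otimes>\<^sub>C y) = (\<Sum>(x, y)\<leftarrow>zs. g x y)"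
proof -
  have "tensor_lift S T f (\<Sum>(x, y)\<leftarrow>zs. x \<otimes>\<^sub>C y) = (\<Sum>(x, y)\<leftarrow>zs. f x y)"
    by (rule tensor_lift_sum_list[OF S T bilinear_on_cong[OF S T eq g] zs])
  also have "\<dots> = (\<Sum>(x, y)\<leftarrow>zs. g x y)"
    using zs by (intro arg_cong[of _ _ sum_list] map_cong) (auto simp: eq)
  finally show ?thesis .
qed

lemma sum_list_pairs_cong:
  assumes "\<And>x y. (x, y) \<in> set zs \<Longrightarrow> f x y = g x y"
  shows "(\<Sum>(x, y)\<leftarrow>zs. f x y) = (\<Sum>(x, y)\<leftarrow>zs. g x y)"
  using assms by (intro arg_cong[of _ _ sum_list] map_cong) auto

lemma sum_list_pairs_zero:
  assumes "\<And>x y. (x, y) \<in> set zs \<Longrightarrow> f x y = 0"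
  shows "(\<Sum>(x, y)\<leftarrow>zs. f x y) = 0"
  using assms by (induction zs) auto


section \<open>Products in degree one\<close>

context cdga begin

lemma linear_product:
  "y \<in> component A j \<Longrightarrow> linear_on (component A i) (\<lambda>x. product A i j x y)"
  "x \<in> component A i \<Longrightarrow> linear_on (component A j) (product A i j x)"
  using bilinear_product by (auto simp: bilinear_on_def)

lemma product_zero [simp]:
  "y \<in> component A j \<Longrightarrow> product A i j 0 y = 0"
  "x \<in> component A i \<Longrightarrow> product A i j x 0 = 0"
proof -
  have *: "f 0 = 0" if "linear_on (component A k) f" for k and f :: "'a \<Rightarrow> 'a"
  proof -
    have "f (0 *\<^sub>C 0) = 0 *\<^sub>C f 0"
      using that complex_vector.subspace_0[OF subspace_component[of k]] unfolding linear_on_def by blast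
    then show ?thesis by simp
  qed
  show "y \<in> component A j \<Longrightarrow> product A i j 0 y = 0"
    by (rule *[OF linear_product(1)])
  show "x \<in> component A i \<Longrightarrow> product A i j x 0 = 0"
    by (rule *[OF linear_product(2)])
qed

lemma anticommute_degree_1:
  assumes "x \<in> component A 1" and "y \<in> component A 1"
  shows "product A 1 1 y x = - product A 1 1 x y"
proof -
  have "product A 1 1 y x = (-1) ^ (1 * 1) *\<^sub>C product A 1 1 x y"
    by (rule product_commute[OF assms])
  also have "\<dots> = - product A 1 1 x y"
    by simp
  finally show ?thesis .
qed

lemma square_degree_1:
  assumes "x \<in> component A 1"
  shows "product A 1 1 x x = 0"
proof -
  have "product A 1 1 x x + product A 1 1 x x = 0"
    using anticommute_degree_1[OF assms assms] by (metis add.right_inverse)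
  then show ?thesis by (simp only: add_self_eq_0_iff)
qed

lemma differential_unity: "differential A 0 (unity A) = 0"
  using leibniz[OF unity_closed unity_closed] product_unity_left[OF unity_closed]
    product_unity_left[OF differential_closed[OF unity_closed]]
    product_unity_right[OF differential_closed[OF unity_closed]]
  by (simp add: scaleC_one)

text \<open>So a subspace spanned by elements with pairwise zero products is isotropic.\<close>

lemma product_span_zero:
  assumes G: "G \<subseteq> component A i" and zero: "\<And>x y. x \<in> G \<Longrightarrow> y \<in> G \<Longrightarrow> product A i i x y = 0"
    and "x \<in> cspan G" and "y \<in> cspan G"
  shows "product A i i x y = 0"
proof -
  have span: "cspan G \<subseteq> component A i"
    by (rule complex_vector.span_minimal[OF G subspace_component])
  have 1: "product A i i x y = 0" if "x \<in> G" "y \<in> cspan G" for x y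
  proof -
    have "csubspace {z \<in> component A i. product A i i x z = 0}"
      using linear_product(2)[of x i i] subspace_component[of i] G that(1)
      by (auto simp: complex_vector.subspace_def linear_on_def)
    from complex_vector.span_minimal[OF _ this, of G] show ?thesis
      using zero[OF that(1)] G that(2) by blast
  qed
  have "csubspace {z \<in> component A i. product A i i z y = 0}"
    using linear_product(1)[of y i i] subspace_component[of i] span assms(4)
    by (auto simp: complex_vector.subspace_def linear_on_def)
  from complex_vector.span_minimal[OF _ this, of G] show ?thesis
    using 1 G assms(3,4) by blast
qed

end


section \<open>Flat connections\<close>

text \<open>The left-hand side of the Maurer-Cartan equation, evaluated on a representative of the
  connection.  It does not refer to the graded pieces or to the space of the Lie algebra, so the
  same expression serves for \<open>A\<close> and for its sub-algebras.\<close>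

definition curvature ::
    "'a::complex_vector dga \<Rightarrow> 'g::complex_vector lie \<Rightarrow> ('a \<times> 'g) list \<Rightarrow> ('a, 'g) tensor"
  where "curvature A L zs =
    (\<Sum>(\<eta>, g)\<leftarrow>zs. differential A 1 \<eta> \<otimes>\<^sub>C g) +
    (1/2) *\<^sub>C (\<Sum>(\<eta>, g)\<leftarrow>zs. \<Sum>(\<eta>', g')\<leftarrow>zs. product A 1 1 \<eta> \<eta>' \<otimes>\<^sub>C bracket L g g')"

lemma flat_connections_iff_curvature:
  assumes "cdga A" and "lie_algebra L" and zs: "set zs \<subseteq> component A 1 \<times> lie_space L"
  shows "(\<Sum>(\<eta>, g)\<leftarrow>zs. \<eta> \<otimes>\<^sub>C g) \<in> flat_connections A L \<longleftrightarrow> curvature A L zs = 0"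
proof -
  interpret cdga A by fact
  interpret lie_algebra L by fact
  let ?\<omega> = "\<Sum>(\<eta>, g)\<leftarrow>zs. \<eta> \<otimes>\<^sub>C g"
  have bracket: "linear_on (lie_space L) (\<lambda>x. bracket L x y)" "linear_on (lie_space L) (bracket L y)"
    if "y \<in> lie_space L" for y
    using bilinear_bracket that by (auto simp: bilinear_on_def)
  have "tensor_diff A L 1 ?\<omega> = (\<Sum>(\<eta>, g)\<leftarrow>zs. differential A 1 \<eta> \<otimes>\<^sub>C g)"
    unfolding tensor_diff_def
    by (intro tensor_lift_sum_list subspace_component subspace_lie_space zs
        bilinear_on_tens linear_differential linear_on_id)
  moreover have "tensor_bracket A L 1 1 ?\<omega> ?\<omega> =
      (\<Sum>(\<eta>, g)\<leftarrow>zs. \<Sum>(\<eta>', g')\<leftarrow>zs. product A 1 1 \<eta> \<eta>' \<otimes>\<^sub>C bracket L g g')"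
    unfolding tensor_bracket_def
  proof (rule tensor_lift_sum_list_cong)
    fix \<eta> g assume "\<eta> \<in> component A 1" "g \<in> lie_space L"
    then show "tensor_lift (component A 1) (lie_space L) (\<lambda>\<beta> y. product A 1 1 \<eta> \<beta> \<otimes>\<^sub>C bracket L g y) ?\<omega> =
        (\<Sum>(\<eta>', g')\<leftarrow>zs. product A 1 1 \<eta> \<eta>' \<otimes>\<^sub>C bracket L g g')"
      by (intro tensor_lift_sum_list subspace_component subspace_lie_space zs
          bilinear_on_tens linear_product bracket)
  next
    show "bilinear_on (component A 1) (lie_space L)
        (\<lambda>\<eta> g. \<Sum>(\<eta>', g')\<leftarrow>zs. product A 1 1 \<eta> \<eta>' \<otimes>\<^sub>C bracket L g g')"
      using zs by (intro bilinear_on_sum_list bilinear_on_tens linear_product bracket) auto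
  qed (rule subspace_component subspace_lie_space zs)+
  ultimately show ?thesis
    using sum_list_in_tensor_space[OF zs] by (simp add: flat_connections_def curvature_def)
qed

lemma flat_connections_sum_list:
  assumes "cdga A" and "\<omega> \<in> flat_connections A L"
  obtains zs where "set zs \<subseteq> component A 1 \<times> lie_space L" "\<omega> = (\<Sum>(\<eta>, g)\<leftarrow>zs. \<eta> \<otimes>\<^sub>C g)"
  using tensor_space_sum_list[OF cdga.subspace_component[OF assms(1)]] assms(2)
  unfolding flat_connections_def by blast

lemma flat_connections_sub_dga:
  assumes A: "cdga A" and L: "lie_algebra L" and C: "csubspace C" "C \<subseteq> component A 1"
  shows "flat_connections (sub_dga A C) L = flat_connections A L \<inter> tensor_space C (lie_space L)"
proof -
  have B: "cdga (sub_dga A C)" by (rule cdga_sub_dga[OF A C])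
  have B1: "component (sub_dga A C) 1 = C" by (simp add: sub_dga_def)
  have curv: "curvature (sub_dga A C) L zs = curvature A L zs" for zs
    by (simp add: curvature_def sub_dga_def truncation2_def)
  have "\<omega> \<in> flat_connections (sub_dga A C) L \<longleftrightarrow> \<omega> \<in> flat_connections A L"
    if "\<omega> \<in> tensor_space C (lie_space L)" for \<omega>
  proof -
    obtain zs where zs: "set zs \<subseteq> C \<times> lie_space L" "\<omega> = (\<Sum>(\<eta>, g)\<leftarrow>zs. \<eta> \<otimes>\<^sub>C g)"
      using tensor_space_sum_list[OF C(1) \<open>\<omega> \<in> _\<close>] by blast
    then have "set zs \<subseteq> component A 1 \<times> lie_space L" using C(2) by blast
    with zs B1 show ?thesis
      using flat_connections_iff_curvature[OF A L] flat_connections_iff_curvature[OF B L]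
      by (simp add: curv)
  qed
  then show ?thesis unfolding flat_connections_def B1 by blast
qed

lemma rank_one_flat_subset:
  assumes "cdga A" and "lie_algebra L"
  shows "rank_one_flat A L \<subseteq> flat_connections A L"
proof
  interpret cdga A by fact
  interpret lie_algebra L by fact
  fix \<omega> assume "\<omega> \<in> rank_one_flat A L"
  then obtain \<eta> g where \<omega>: "\<omega> = \<eta> \<otimes>\<^sub>C g" and "\<eta> \<in> component A 1" "differential A 1 \<eta> = 0" "g \<in> lie_space L"
    unfolding rank_one_flat_def by blast
  then have "curvature A L [(\<eta>, g)] = 0" "set [(\<eta>, g)] \<subseteq> component A 1 \<times> lie_space L"
    by (simp_all add: curvature_def bracket_self)
  from flat_connections_iff_curvature[OF assms this(2)] this(1)
  show "\<omega> \<in> flat_connections A L" by (simp add: \<omega>)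
qed

text \<open>The equations of \<open>C \<otimes> \<gg>\<close> are linear, hence polynomial.\<close>

lemma zariski_closed_sub_dga:
  assumes A: "cdga A" and L: "lie_algebra L" and C: "csubspace C" "C \<subseteq> component A 1"
  shows "zariski_closed_in (flat_connections A L) (flat_connections (sub_dga A C) L)"
proof -
  from tensor_space_cut_out_by_functionals[OF C(1), of "lie_space L"]
  obtain P :: "(('a, 'b) tensor \<Rightarrow> complex) set" where P: "\<forall>p\<in>P. linear_on UNIV p"
    and "\<forall>S'. csubspace S' \<and> C \<subseteq> S' \<longrightarrow>
      tensor_space C (lie_space L) = {t \<in> tensor_space S' (lie_space L). \<forall>p\<in>P. p t = 0}"
    by (elim exE conjE)
  then have eq: "tensor_space C (lie_space L) =
      {t \<in> tensor_space (component A 1) (lie_space L). \<forall>p\<in>P. p t = 0}"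
    using cdga.subspace_component[OF A] C(2) by simp
  have "P \<subseteq> polynomial_functions"
    using P polynomial_functions.linear by blast
  moreover have "flat_connections A L \<inter> tensor_space C (lie_space L) =
      {\<omega> \<in> flat_connections A L. \<forall>p\<in>P. p \<omega> = 0}"
    unfolding flat_connections_def eq by auto
  ultimately show ?thesis
    unfolding zariski_closed_in_def flat_connections_sub_dga[OF assms] by blast
qed


section \<open>Twisted cohomology in degree one\<close>

lemma subspace_linear_image:
  assumes f: "linear_on UNIV f" and S: "csubspace S"
  shows "csubspace (f ` S)"
proof (rule complex_vector.subspaceI)
  show "0 \<in> f ` S"
    using linear_on_UNIV_simps(3)[OF f] complex_vector.subspace_0[OF S] by (metis imageI)
  show "x + y \<in> f ` S" if "x \<in> f ` S" "y \<in> f ` S" for x y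
    using that by (auto simp: complex_vector.subspace_add[OF S] simp flip: linear_on_UNIV_simps(1)[OF f])
  show "c *\<^sub>C x \<in> f ` S" if "x \<in> f ` S" for c x
    using that by (auto simp: complex_vector.subspace_scale[OF S] simp flip: linear_on_UNIV_simps(2)[OF f])
qed

text \<open>Independent modulo \<open>B\<close> means, for a single vector, not in \<open>B\<close>; and no member of a set independent
  modulo \<open>B\<close> lies in \<open>B\<close>.\<close>

lemma quotient_dim_ge_1_iff:
  assumes B: "csubspace B"
  shows "quotient_dim Z B \<ge> enat 1 \<longleftrightarrow> (\<exists>z\<in>Z. z \<notin> B)"
proof -
  let ?I = "{S. finite S \<and> S \<subseteq> Z \<and> (\<forall>c. (\<Sum>s\<in>S. c s *\<^sub>C s) \<in> B \<longrightarrow> (\<forall>s\<in>S. c s = 0))}"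
  show ?thesis
  proof
    assume ge: "quotient_dim Z B \<ge> enat 1"
    have "\<exists>S\<in>?I. S \<noteq> {}"
    proof (rule ccontr)
      assume "\<not> (\<exists>S\<in>?I. S \<noteq> {})"
      then have "quotient_dim Z B \<le> enat 0"
        unfolding quotient_dim_def by (intro SUP_least) auto
      then have "enat 1 \<le> enat 0" using ge order_trans by blast
      then show False by simp
    qed
    then obtain S s where S: "S \<in> ?I" "s \<in> S" by blast
    have "s \<notin> B"
    proof
      assume "s \<in> B"
      let ?c = "\<lambda>r. if r = s then 1 else (0 :: complex)"
      have "(\<Sum>r\<in>S. ?c r *\<^sub>C r) = (\<Sum>r\<in>S. if r = s then r else 0)"
        by (intro sum.cong) (auto simp: scaleC_one)
      also have "\<dots> = s" using S by simp
      finally have "(\<Sum>r\<in>S. ?c r *\<^sub>C r) \<in> B" using \<open>s \<in> B\<close> by simp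
      moreover have "\<forall>c. (\<Sum>r\<in>S. c r *\<^sub>C r) \<in> B \<longrightarrow> (\<forall>r\<in>S. c r = 0)" using S(1) by simp
      ultimately have "\<forall>r\<in>S. ?c r = 0" by (elim allE[of _ ?c] impE)
      with S(2) show False by auto
    qed
    with S show "\<exists>z\<in>Z. z \<notin> B" by blast
  next
    assume "\<exists>z\<in>Z. z \<notin> B"
    then obtain z where z: "z \<in> Z" "z \<notin> B" by blast
    have "c = 0" if "c *\<^sub>C z \<in> B" for c
    proof (rule ccontr)
      assume "c \<noteq> 0"
      then have "z = (1 / c) *\<^sub>C (c *\<^sub>C z)" by (simp add: scaleC_one)
      also have "\<dots> \<in> B" by (rule complex_vector.subspace_scale[OF B that])
      finally show False using z(2) by contradiction
    qed
    then have "{z} \<in> ?I" using z(1) by simp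
    then have "enat (card {z}) \<le> quotient_dim Z B"
      unfolding quotient_dim_def by (rule SUP_upper)
    then show "quotient_dim Z B \<ge> enat 1" by simp
  qed
qed

lemma rep_linear:
  assumes "lie_rep L \<theta>"
  shows "g \<in> lie_space L \<Longrightarrow> linear_on UNIV (\<theta> g)" "linear_on (lie_space L) (\<lambda>g. \<theta> g v)"
  using lie_rep.bilinear_rep[OF assms] by (auto simp: bilinear_on_def)

lemma twisted_diff_linear:
  fixes \<theta> :: "'g::complex_vector \<Rightarrow> 'v::complex_vector \<Rightarrow> 'v"
  assumes "cdga A" and "lie_algebra L" and rep: "lie_rep L \<theta>"
    and zs: "set zs \<subseteq> component A 1 \<times> lie_space L"
  defines "\<omega> \<equiv> \<Sum>(\<eta>, g)\<leftarrow>zs. \<eta> \<otimes>\<^sub>C g"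
  shows "\<exists>D. linear_on UNIV D \<and>
    (\<forall>t\<in>tensor_space (component A i) UNIV. twisted_diff A L \<theta> \<omega> i t = D t) \<and>
    (\<forall>\<alpha>\<in>component A i. \<forall>v. D (\<alpha> \<otimes>\<^sub>C v) =
      differential A i \<alpha> \<otimes>\<^sub>C v + (\<Sum>(\<eta>, g)\<leftarrow>zs. product A 1 i \<eta> \<alpha> \<otimes>\<^sub>C \<theta> g v))"
proof -
  interpret cdga A by fact
  interpret lie_algebra L by fact
  define G where "G \<alpha> v = differential A i \<alpha> \<otimes>\<^sub>C v +
      (\<Sum>(\<eta>, g)\<leftarrow>zs. product A 1 i \<eta> \<alpha> \<otimes>\<^sub>C \<theta> g v)" for \<alpha> v
  define F where "F \<alpha> v = differential A i \<alpha> \<otimes>\<^sub>C v +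
      tensor_lift (component A 1) (lie_space L) (\<lambda>\<eta> g. product A 1 i \<eta> \<alpha> \<otimes>\<^sub>C \<theta> g v) \<omega>" for \<alpha> v
  have FG: "F \<alpha> v = G \<alpha> v" if "\<alpha> \<in> component A i" for \<alpha> v
    unfolding F_def G_def \<omega>_def
    by (intro arg_cong2[of _ _ _ _ plus] refl tensor_lift_sum_list subspace_component
        subspace_lie_space zs bilinear_on_tens linear_product that rep_linear[OF rep])
  have "bilinear_on (component A i) UNIV G"
    unfolding G_def using zs
    by (intro bilinear_on_add bilinear_on_sum_list bilinear_on_tens linear_product
        linear_differential linear_on_id rep_linear[OF rep]) auto
  from bilinear_on_cong[OF subspace_component complex_vector.subspace_UNIV FG this]
  have "bilinear_on (component A i) UNIV F" by simp
  from tensor_lift_linear[OF subspace_component complex_vector.subspace_UNIV this]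
  show ?thesis
    unfolding twisted_diff_def F_def[symmetric] using FG by (simp add: G_def)
qed

text \<open>Degree zero consists of the tensors \<open>1 \<otimes> w\<close>, and \<open>d 1 = 0\<close>.\<close>

lemma twisted_coboundaries_1:
  fixes \<theta> :: "'g::complex_vector \<Rightarrow> 'v::complex_vector \<Rightarrow> 'v"
  assumes "cdga A" and "connected_dga A" and "lie_algebra L" and rep: "lie_rep L \<theta>"
    and zs: "set zs \<subseteq> component A 1 \<times> lie_space L"
  shows "twisted_coboundaries A L \<theta> (\<Sum>(\<eta>, g)\<leftarrow>zs. \<eta> \<otimes>\<^sub>C g) 1 =
    range (\<lambda>w. \<Sum>(\<eta>, g)\<leftarrow>zs. \<eta> \<otimes>\<^sub>C \<theta> g w)"
proof -
  interpret cdga A by fact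
  let ?\<omega> = "\<Sum>(\<eta>, g)\<leftarrow>zs. \<eta> \<otimes>\<^sub>C g"
  obtain D where D: "\<And>t. t \<in> tensor_space (component A 0) UNIV \<Longrightarrow> twisted_diff A L \<theta> ?\<omega> 0 t = D t"
    and D_tens: "\<And>\<alpha> v. \<alpha> \<in> component A 0 \<Longrightarrow> D (\<alpha> \<otimes>\<^sub>C v) =
      differential A 0 \<alpha> \<otimes>\<^sub>C v + (\<Sum>(\<eta>, g)\<leftarrow>zs. product A 1 0 \<eta> \<alpha> \<otimes>\<^sub>C \<theta> g v)"
    using twisted_diff_linear[OF assms(1,3) rep zs, of 0] by blast
  have D1: "D (unity A \<otimes>\<^sub>C w) = (\<Sum>(\<eta>, g)\<leftarrow>zs. \<eta> \<otimes>\<^sub>C \<theta> g w)" for w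
  proof -
    have "D (unity A \<otimes>\<^sub>C w) = (\<Sum>(\<eta>, g)\<leftarrow>zs. product A 1 0 \<eta> (unity A) \<otimes>\<^sub>C \<theta> g w)"
      using D_tens[OF unity_closed] by (simp add: differential_unity)
    also have "\<dots> = (\<Sum>(\<eta>, g)\<leftarrow>zs. \<eta> \<otimes>\<^sub>C \<theta> g w)"
      using zs by (intro sum_list_pairs_cong) (auto simp: product_unity_right)
    finally show ?thesis .
  qed
  have A0: "component A 0 = cspan {unity A}"
    using assms(2) unfolding connected_dga_def by simp
  have "tensor_space (component A 0) UNIV = range (\<lambda>w :: 'v. unity A \<otimes>\<^sub>C w)"
    using tensor_space_line[OF complex_vector.subspace_UNIV, of _ "unity A"]
      tens_in_tensor_space[OF unity_closed] unfolding A0 by blast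
  then have "twisted_diff A L \<theta> ?\<omega> 0 ` tensor_space (component A 0) UNIV =
      range (\<lambda>w. D (unity A \<otimes>\<^sub>C w))"
    using D by (auto simp: image_iff)
  then show ?thesis by (simp add: twisted_coboundaries_def D1)
qed

lemma resonance_1_1_iff:
  fixes \<theta> :: "'g::complex_vector \<Rightarrow> 'v::complex_vector \<Rightarrow> 'v"
  assumes "cdga A" and "connected_dga A" and "lie_algebra L" and rep: "lie_rep L \<theta>"
    and zs: "set zs \<subseteq> component A 1 \<times> lie_space L"
  defines "\<omega> \<equiv> \<Sum>(\<eta>, g)\<leftarrow>zs. \<eta> \<otimes>\<^sub>C g"
  shows "\<omega> \<in> resonance 1 1 A L \<theta> \<longleftrightarrow> \<omega> \<in> flat_connections A L \<and>
    (\<exists>t\<in>twisted_cocycles A L \<theta> \<omega> 1. \<forall>w. t \<noteq> (\<Sum>(\<eta>, g)\<leftarrow>zs. \<eta> \<otimes>\<^sub>C \<theta> g w))"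
proof -
  let ?E = "\<lambda>w. \<Sum>(\<eta>, g)\<leftarrow>zs. \<eta> \<otimes>\<^sub>C \<theta> g w"
  have "linear_on UNIV ?E"
    using zs rep_linear(1)[OF rep] unfolding case_prod_unfold
    by (intro linear_on_sum_list)
      (auto simp: linear_on_def tens_add_right tens_scaleC_right)
  then have "csubspace (range ?E)"
    by (rule subspace_linear_image[OF _ complex_vector.subspace_UNIV])
  then show ?thesis
    unfolding resonance_def mem_Collect_eq \<omega>_def twisted_coboundaries_1[OF assms(1-4) zs]
      quotient_dim_ge_1_iff[OF \<open>csubspace (range ?E)\<close>] by blast
qed

lemma twisted_cocycles_1_iff:
  fixes \<theta> :: "'g::complex_vector \<Rightarrow> 'v::complex_vector \<Rightarrow> 'v"
  assumes "cdga A" and "lie_algebra L" and "lie_rep L \<theta>"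
    and d0: "\<forall>x\<in>component A 1. differential A 1 x = 0"
    and zs: "set zs \<subseteq> component A 1 \<times> lie_space L" and ws: "set ws \<subseteq> component A 1 \<times> UNIV"
  shows "(\<Sum>(\<alpha>, v)\<leftarrow>ws. \<alpha> \<otimes>\<^sub>C v) \<in> twisted_cocycles A L \<theta> (\<Sum>(\<eta>, g)\<leftarrow>zs. \<eta> \<otimes>\<^sub>C g) 1 \<longleftrightarrow>
    (\<Sum>(\<alpha>, v)\<leftarrow>ws. \<Sum>(\<eta>, g)\<leftarrow>zs. product A 1 1 \<eta> \<alpha> \<otimes>\<^sub>C \<theta> g v) = 0"
proof -
  let ?\<omega> = "\<Sum>(\<eta>, g)\<leftarrow>zs. \<eta> \<otimes>\<^sub>C g"
  obtain D where lin: "linear_on UNIV D"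
    and D: "\<And>t. t \<in> tensor_space (component A 1) UNIV \<Longrightarrow> twisted_diff A L \<theta> ?\<omega> 1 t = D t"
    and D_tens: "\<And>\<alpha> v. \<alpha> \<in> component A 1 \<Longrightarrow> D (\<alpha> \<otimes>\<^sub>C v) =
      differential A 1 \<alpha> \<otimes>\<^sub>C v + (\<Sum>(\<eta>, g)\<leftarrow>zs. product A 1 1 \<eta> \<alpha> \<otimes>\<^sub>C \<theta> g v)"
    using twisted_diff_linear[OF assms(1,2,3) zs, of 1] by blast
  have "D (\<Sum>(\<alpha>, v)\<leftarrow>ws. \<alpha> \<otimes>\<^sub>C v) =
      (\<Sum>(\<alpha>, v)\<leftarrow>ws. \<Sum>(\<eta>, g)\<leftarrow>zs. product A 1 1 \<eta> \<alpha> \<otimes>\<^sub>C \<theta> g v)"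
    unfolding linear_on_UNIV_sum_list[OF lin]
    using ws d0 by (intro sum_list_pairs_cong) (auto simp: D_tens)
  then show ?thesis
    using sum_list_in_tensor_space[OF ws] D unfolding twisted_cocycles_def by auto
qed


section \<open>Rank one resonance\<close>

lemma lie_algebra_abelian_line: "lie_algebra abelian_line"
  by unfold_locales (auto simp: abelian_line_def bilinear_on_def linear_on_def)

lemma lie_rep_abelian_line: "lie_rep abelian_line (\<lambda>c v :: complex. c * v)"
  by unfold_locales (auto simp: abelian_line_def bilinear_on_def linear_on_def
      scaleC_complex_def algebra_simps)

lemma tensor_space_complex:
  assumes S: "csubspace S" and t: "t \<in> tensor_space S (UNIV :: complex set)"
  shows "\<exists>x\<in>S. t = x \<otimes>\<^sub>C 1"
proof -
  have "csubspace ((\<lambda>x. x \<otimes>\<^sub>C (1::complex)) ` S)"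
    by (rule subspace_linear_image[OF tens_linear(1) S])
  moreover have "x \<otimes>\<^sub>C c \<in> (\<lambda>x. x \<otimes>\<^sub>C (1::complex)) ` S" if "x \<in> S" for x c
    using complex_vector.subspace_scale[OF S that, of c]
    by (intro image_eqI[of _ _ "c *\<^sub>C x"])
      (simp_all add: tens_scaleC_left flip: tens_scaleC_right, simp add: scaleC_complex_def)
  ultimately have "tensor_space S UNIV \<subseteq> (\<lambda>x. x \<otimes>\<^sub>C (1::complex)) ` S"
    unfolding tensor_space_def by (intro complex_vector.span_minimal) auto
  with t show ?thesis by blast
qed

text \<open>Identify \<open>\<beta> \<otimes> 1\<close> with \<open>\<beta>\<close>.  The twisted complex is then multiplication by \<open>\<alpha>\<close>: its cocycles in
  degree one are the annihilator of \<open>\<alpha>\<close>, and its coboundaries the line of \<open>\<alpha>\<close>.\<close>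

lemma rank_one_resonance_iff:
  assumes "cdga A" and "connected_dga A" and d0: "\<forall>x\<in>component A 1. differential A 1 x = 0"
  shows "\<alpha> \<in> rank_one_resonance 1 1 A \<longleftrightarrow>
    \<alpha> \<in> component A 1 \<and> (\<exists>\<beta>\<in>component A 1. product A 1 1 \<alpha> \<beta> = 0 \<and> \<beta> \<notin> cspan {\<alpha>})"
proof (cases "\<alpha> \<in> component A 1")
  case True
  interpret cdga A by fact
  let ?\<theta> = "\<lambda>c v :: complex. c * v"
  have zs: "set [(\<alpha>, 1::complex)] \<subseteq> component A 1 \<times> lie_space abelian_line"
    using True by (simp add: abelian_line_def)
  have flat: "\<alpha> \<otimes>\<^sub>C (1::complex) \<in> flat_connections A abelian_line"
    using rank_one_flat_subset[OF assms(1) lie_algebra_abelian_line] True d0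
    unfolding rank_one_flat_def abelian_line_def by auto
  have cocycle: "\<beta> \<otimes>\<^sub>C 1 \<in> twisted_cocycles A abelian_line ?\<theta> (\<alpha> \<otimes>\<^sub>C 1) 1 \<longleftrightarrow> product A 1 1 \<alpha> \<beta> = 0"
    if "\<beta> \<in> component A 1" for \<beta>
    using twisted_cocycles_1_iff[OF assms(1) lie_algebra_abelian_line lie_rep_abelian_line d0 zs,
        of "[(\<beta>, 1)]"] that by (simp add: tens_eq_0_iff)
  have coboundary: "(\<exists>w::complex. \<beta> \<otimes>\<^sub>C 1 = \<alpha> \<otimes>\<^sub>C w) \<longleftrightarrow> \<beta> \<in> cspan {\<alpha>}" for \<beta>
  proof -
    have "\<beta> \<otimes>\<^sub>C 1 = \<alpha> \<otimes>\<^sub>C w \<longleftrightarrow> \<beta> = w *\<^sub>C \<alpha>" for w :: complex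
    proof -
      have "\<alpha> \<otimes>\<^sub>C w = (w *\<^sub>C \<alpha>) \<otimes>\<^sub>C 1"
        using tens_scaleC_right[of \<alpha> w "1::complex"] by (simp add: scaleC_complex_def tens_scaleC_left)
      then have "\<beta> \<otimes>\<^sub>C 1 = \<alpha> \<otimes>\<^sub>C w \<longleftrightarrow> \<beta> \<otimes>\<^sub>C (1::complex) - (w *\<^sub>C \<alpha>) \<otimes>\<^sub>C 1 = 0"
        by simp
      also have "\<dots> \<longleftrightarrow> (\<beta> - w *\<^sub>C \<alpha>) \<otimes>\<^sub>C (1::complex) = 0"
        by (simp add: linear_on_UNIV_simps(5)[OF tens_linear(1)])
      finally show ?thesis by (simp add: tens_eq_0_iff)
    qed
    then show ?thesis by (auto simp: complex_vector.span_singleton)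
  qed
  have "twisted_cocycles A abelian_line ?\<theta> (\<alpha> \<otimes>\<^sub>C 1) 1 \<subseteq> (\<lambda>\<beta>. \<beta> \<otimes>\<^sub>C 1) ` component A 1"
    using tensor_space_complex[OF subspace_component] unfolding twisted_cocycles_def by blast
  then have "(\<exists>t\<in>twisted_cocycles A abelian_line ?\<theta> (\<alpha> \<otimes>\<^sub>C 1) 1. \<forall>w. t \<noteq> \<alpha> \<otimes>\<^sub>C w) \<longleftrightarrow>
      (\<exists>\<beta>\<in>component A 1. product A 1 1 \<alpha> \<beta> = 0 \<and> \<beta> \<notin> cspan {\<alpha>})"
    using cocycle coboundary by blast
  moreover have "\<alpha> \<otimes>\<^sub>C 1 \<in> resonance 1 1 A abelian_line ?\<theta> \<longleftrightarrow>
      (\<exists>t\<in>twisted_cocycles A abelian_line ?\<theta> (\<alpha> \<otimes>\<^sub>C 1) 1. \<forall>w. t \<noteq> \<alpha> \<otimes>\<^sub>C w)"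
  proof -
    have "range (\<lambda>w. \<alpha> \<otimes>\<^sub>C (1 * w)) = range (\<lambda>w :: complex. \<alpha> \<otimes>\<^sub>C w)" by simp
    then show ?thesis
      using resonance_1_1_iff[OF assms(1,2) lie_algebra_abelian_line lie_rep_abelian_line zs] flat
      by simp
  qed
  ultimately show ?thesis
    using True by (simp add: rank_one_resonance_def)
qed (simp add: rank_one_resonance_def)


section \<open>Resonance of rank one and of isotropic connections\<close>

text \<open>In a finite basis of the second factor, the contractions with the coordinate functionals are the
  coefficients of \<open>t\<close>.  This turns a statement about the kernel of \<open>f \<otimes> id\<close> into one about the
  kernel of \<open>f\<close>.\<close>

lemma tensor_by_contractions:
  fixes t :: "('a::complex_vector, 'v::complex_vector) tensor"
  assumes "fin_dim (UNIV :: 'v set)" and S: "csubspace S" and t: "t \<in> tensor_space S UNIV"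
    and K: "csubspace K"
    and slices: "\<And>\<phi> F. linear_on UNIV \<phi> \<Longrightarrow> linear_on UNIV F \<Longrightarrow> (\<And>x y. F (x \<otimes>\<^sub>C y) = \<phi> y *\<^sub>C x) \<Longrightarrow> F t \<in> K"
  shows "t \<in> tensor_space K UNIV"
proof -
  obtain B :: "'v set" where "finite_dimensional_vector_space scaleC B"
    using fin_dim_UNIV_basis[OF assms(1)] .
  then interpret fd: finite_dimensional_vector_space scaleC B .
  have B: "\<not> cdependent B" "cspan B = UNIV" "finite B"
    using fd.independent_Basis fd.span_Basis fd.finite_Basis unfolding cdependent_raw_def cspan_raw_def by auto
  have lin: "linear_on UNIV (\<lambda>v. crepresentation B v b)" for b
    using B by (simp add: linear_on_def complex_vector.representation_add
        complex_vector.representation_scale scaleC_complex_def)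
  have "\<exists>F. linear_on UNIV F \<and> (\<forall>(x::'a) y. F (x \<otimes>\<^sub>C y) = crepresentation B y b *\<^sub>C x)" for b
    by (rule contract_right[OF lin])
  then obtain F where F: "linear_on UNIV (F b)" "F b (x \<otimes>\<^sub>C y) = crepresentation B y b *\<^sub>C x"
    for b and x :: 'a and y by metis
  have pure: "(\<Sum>b\<in>B. F b (x \<otimes>\<^sub>C y) \<otimes>\<^sub>C b) = x \<otimes>\<^sub>C y" for x :: 'a and y :: 'v
  proof -
    have "(\<Sum>b\<in>B. F b (x \<otimes>\<^sub>C y) \<otimes>\<^sub>C b) = (\<Sum>b\<in>B. x \<otimes>\<^sub>C (crepresentation B y b *\<^sub>C b))"
      by (simp add: F(2) tens_scaleC_left tens_scaleC_right)
    also have "\<dots> = x \<otimes>\<^sub>C (\<Sum>b\<in>B. crepresentation B y b *\<^sub>C b)"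
      using module_hom.sum[OF Vector_Spaces.linear.axioms(3)[OF tens_linear(2)[unfolded linear_on_UNIV_iff]], symmetric] .
    also have "\<dots> = x \<otimes>\<^sub>C y"
      using B complex_vector.sum_representation_eq[of B y B] by simp
    finally show ?thesis .
  qed
  obtain zs where zs: "t = (\<Sum>(x, y)\<leftarrow>zs. x \<otimes>\<^sub>C y)"
    using tensor_space_sum_list[OF S t] by blast
  have rep: "(\<Sum>b\<in>B. F b t \<otimes>\<^sub>C b) = t"
    unfolding zs
    by (induction zs) (auto simp: linear_on_UNIV_simps[OF F(1)] tens_add_left sum.distrib pure)
  have "(\<Sum>b\<in>B. F b t \<otimes>\<^sub>C b) \<in> tensor_space K UNIV"
    by (intro complex_vector.subspace_sum subspace_tensor_space tens_in_tensor_space UNIV_I)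
      (rule slices[OF lin F(1) F(2)])
  with rep show ?thesis by simp
qed

text \<open>The twisted differential of \<open>\<eta> \<otimes> g\<close> is \<open>(\<eta> \<cdot>) \<otimes> \<theta> g\<close>, and its coboundaries are the tensors
  \<open>\<eta> \<otimes> \<theta> g w\<close>.  If \<open>\<eta> \<beta> = 0\<close> with \<open>\<beta>\<close> outside the line of \<open>\<eta>\<close>, then \<open>\<beta> \<otimes> v\<close> is a cocycle for every
  \<open>v\<close>, and no coboundary when \<open>v \<noteq> 0\<close>.  If \<open>\<eta> \<noteq> 0\<close> and \<open>u\<close> is not in the image of
  \<open>\<theta> g\<close>, then \<open>\<eta> \<otimes> u\<close> is a cocycle, because \<open>\<eta>\<^sup>2 = 0\<close>, and no coboundary; if \<open>\<eta> = 0\<close>, every tensor is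
  a cocycle and only \<open>0\<close> is a coboundary.  If \<open>\<theta> g\<close> is invertible, a cocycle lies in the tensor product of the annihilator
  of \<open>\<eta>\<close> with \<open>V\<close>; when that annihilator is the line of \<open>\<eta>\<close>, every cocycle is some
  \<open>\<eta> \<otimes> y = \<eta> \<otimes> \<theta> g w\<close>.\<close>

lemma resonance_of_rank_one:
  fixes \<theta> :: "'g::complex_vector \<Rightarrow> 'v::complex_vector \<Rightarrow> 'v"
  assumes "cdga A" and "connected_dga A" and L: "lie_algebra L" and rep: "lie_rep L \<theta>"
    and d0: "\<forall>x\<in>component A 1. differential A 1 x = 0" and A1: "component A 1 \<noteq> {0}"
    and V: "fin_dim (UNIV :: 'v set)" "\<exists>v::'v. v \<noteq> 0"
    and \<eta>: "\<eta> \<in> component A 1" and g: "g \<in> lie_space L"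
  shows "\<eta> \<otimes>\<^sub>C g \<in> resonance 1 1 A L \<theta> \<longleftrightarrow> endo_det (\<theta> g) = 0 \<or> \<eta> \<in> rank_one_resonance 1 1 A"
proof -
  interpret cdga A by fact
  have zs: "set [(\<eta>, g)] \<subseteq> component A 1 \<times> lie_space L"
    using \<eta> g by simp
  have lin: "linear_on UNIV (\<theta> g)"
    by (rule rep_linear(1)[OF rep g])
  have det: "endo_det (\<theta> g) = 0 \<longleftrightarrow> \<not> surj (\<theta> g)"
    using endo_det_eq_0_iff[OF V(1) lin] endo_surj_iff_inj[OF V(1) lin] by blast
  have "\<eta> \<otimes>\<^sub>C g \<in> flat_connections A L"
    using rank_one_flat_subset[OF assms(1) L] \<eta> g d0 unfolding rank_one_flat_def by blast
  then have res: "\<eta> \<otimes>\<^sub>C g \<in> resonance 1 1 A L \<theta> \<longleftrightarrow>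
      (\<exists>t\<in>twisted_cocycles A L \<theta> (\<eta> \<otimes>\<^sub>C g) 1. \<forall>w. t \<noteq> \<eta> \<otimes>\<^sub>C \<theta> g w)"
    using resonance_1_1_iff[OF assms(1,2) L rep zs] by simp
  have cocycle: "(\<Sum>(\<alpha>, v)\<leftarrow>ws. \<alpha> \<otimes>\<^sub>C v) \<in> twisted_cocycles A L \<theta> (\<eta> \<otimes>\<^sub>C g) 1 \<longleftrightarrow>
      (\<Sum>(\<alpha>, v)\<leftarrow>ws. product A 1 1 \<eta> \<alpha> \<otimes>\<^sub>C \<theta> g v) = 0"
    if "set ws \<subseteq> component A 1 \<times> UNIV" for ws
    using twisted_cocycles_1_iff[OF assms(1) L rep d0 zs that] by simp
  show ?thesis
  proof
    assume "endo_det (\<theta> g) = 0 \<or> \<eta> \<in> rank_one_resonance 1 1 A"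
    then show "\<eta> \<otimes>\<^sub>C g \<in> resonance 1 1 A L \<theta>"
    proof (elim disjE)
      assume "\<eta> \<in> rank_one_resonance 1 1 A"
      then obtain \<beta> where \<beta>: "\<beta> \<in> component A 1" "product A 1 1 \<eta> \<beta> = 0" "\<beta> \<notin> cspan {\<eta>}"
        using rank_one_resonance_iff[OF assms(1,2) d0] by blast
      obtain v :: 'v where "v \<noteq> 0" using V(2) by blast
      obtain \<phi> :: "'a \<Rightarrow> complex" where \<phi>: "linear_on UNIV \<phi>" "\<phi> \<beta> = 1" "\<forall>y\<in>cspan {\<eta>}. \<phi> y = 0"
        using separating_functional[OF complex_vector.subspace_span \<beta>(3)] by blast
      obtain F where F: "linear_on UNIV F" "\<And>x (y :: 'v). F (x \<otimes>\<^sub>C y) = \<phi> x *\<^sub>C y"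
        using contract_left[OF \<phi>(1)] by blast
      have "\<beta> \<otimes>\<^sub>C v \<noteq> \<eta> \<otimes>\<^sub>C \<theta> g w" for w
      proof
        assume "\<beta> \<otimes>\<^sub>C v = \<eta> \<otimes>\<^sub>C \<theta> g w"
        then have "F (\<beta> \<otimes>\<^sub>C v) = F (\<eta> \<otimes>\<^sub>C \<theta> g w)" by simp
        with \<phi> \<open>v \<noteq> 0\<close> show False by (simp add: F(2) complex_vector.span_base)
      qed
      moreover have "\<beta> \<otimes>\<^sub>C v \<in> twisted_cocycles A L \<theta> (\<eta> \<otimes>\<^sub>C g) 1"
        using cocycle[of "[(\<beta>, v)]"] \<beta> by simp
      ultimately show ?thesis using res by blast
    next
      assume "endo_det (\<theta> g) = 0"
      show ?thesis
      proof (cases "\<eta> = 0")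
        case True
        obtain \<beta> where \<beta>: "\<beta> \<in> component A 1" "\<beta> \<noteq> 0"
          using A1 complex_vector.subspace_0[OF subspace_component] by blast
        obtain v :: 'v where "v \<noteq> 0" using V(2) by blast
        have "\<beta> \<otimes>\<^sub>C v \<in> twisted_cocycles A L \<theta> (\<eta> \<otimes>\<^sub>C g) 1"
          using cocycle[of "[(\<beta>, v)]"] \<beta> True by simp
        moreover have "\<beta> \<otimes>\<^sub>C v \<noteq> \<eta> \<otimes>\<^sub>C \<theta> g w" for w
          using \<beta>(2) \<open>v \<noteq> 0\<close> tens_eq_0_iff[of \<beta> v] True by simp
        ultimately show ?thesis using res by blast
      next
        case False
        obtain u where u: "u \<notin> range (\<theta> g)"
          using \<open>endo_det (\<theta> g) = 0\<close> det by blast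
        have "\<eta> \<otimes>\<^sub>C u \<noteq> \<eta> \<otimes>\<^sub>C \<theta> g w" for w
        proof
          assume "\<eta> \<otimes>\<^sub>C u = \<eta> \<otimes>\<^sub>C \<theta> g w"
          then have "\<eta> \<otimes>\<^sub>C (u - \<theta> g w) = 0"
            by (simp add: linear_on_UNIV_simps(5)[OF tens_linear(2)])
          with False u show False by (simp add: tens_eq_0_iff)
        qed
        moreover have "\<eta> \<otimes>\<^sub>C u \<in> twisted_cocycles A L \<theta> (\<eta> \<otimes>\<^sub>C g) 1"
          using cocycle[of "[(\<eta>, u)]"] \<eta> square_degree_1[OF \<eta>] by simp
        ultimately show ?thesis using res by blast
      qed
    qed
  next
    assume "\<eta> \<otimes>\<^sub>C g \<in> resonance 1 1 A L \<theta>"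
    then obtain t where t: "t \<in> twisted_cocycles A L \<theta> (\<eta> \<otimes>\<^sub>C g) 1" "\<And>w. t \<noteq> \<eta> \<otimes>\<^sub>C \<theta> g w"
      using res by blast
    show "endo_det (\<theta> g) = 0 \<or> \<eta> \<in> rank_one_resonance 1 1 A"
    proof (rule ccontr)
      assume contr: "\<not> (endo_det (\<theta> g) = 0 \<or> \<eta> \<in> rank_one_resonance 1 1 A)"
      then have "inj (\<theta> g)" "surj (\<theta> g)"
        using det endo_surj_iff_inj[OF V(1) lin] by blast+
      define h where "h = inv_into UNIV (\<theta> g)"
      have h: "h (\<theta> g v) = v" "\<theta> g (h v) = v" for v
        using \<open>inj (\<theta> g)\<close> \<open>surj (\<theta> g)\<close> by (simp_all add: h_def surj_f_inv_f)
      have lin_h: "linear_on UNIV h"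
      proof -
        have "h (x + y) = h x + h y" "h (c *\<^sub>C x) = c *\<^sub>C h x" for x y c
          using linear_on_UNIV_simps(1)[OF lin, of "h x" "h y"] linear_on_UNIV_simps(2)[OF lin, of c "h x"] h
          by metis+
        then show ?thesis by (simp add: linear_on_def)
      qed
      have tA: "t \<in> tensor_space (component A 1) UNIV"
        using t(1) unfolding twisted_cocycles_def by blast
      then obtain ws where ws: "set ws \<subseteq> component A 1 \<times> UNIV" "t = (\<Sum>(\<alpha>, v)\<leftarrow>ws. \<alpha> \<otimes>\<^sub>C v)"
        using tensor_space_sum_list[OF subspace_component] by blast
      have zero: "(\<Sum>(\<alpha>, v)\<leftarrow>ws. product A 1 1 \<eta> \<alpha> \<otimes>\<^sub>C \<theta> g v) = 0"
        using cocycle[OF ws(1)] t(1) ws(2) by simp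
      have "t \<in> tensor_space (cspan {\<eta>}) UNIV"
      proof (rule tensor_by_contractions[OF V(1) subspace_component tA complex_vector.subspace_span])
        fix \<phi> :: "'v \<Rightarrow> complex" and F :: "('a, 'v) tensor \<Rightarrow> 'a"
        assume \<phi>: "linear_on UNIV \<phi>" and F: "linear_on UNIV F" "\<And>x y. F (x \<otimes>\<^sub>C y) = \<phi> y *\<^sub>C x"
        \<comment> \<open>Contracting the differential of \<open>t\<close> with \<open>\<phi> \<circ> h\<close> cancels \<open>\<theta> g\<close>: the result is \<open>\<eta>\<close> times the contraction of \<open>t\<close> with \<open>\<phi>\<close>.\<close>
        have "linear_on UNIV (\<lambda>v. \<phi> (h v))"
          by (simp add: linear_on_def linear_on_UNIV_simps[OF \<phi>] linear_on_UNIV_simps[OF lin_h])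
        from contract_right[OF this] obtain G where
          G: "linear_on UNIV G" "\<And>(x :: 'a) y. G (x \<otimes>\<^sub>C y) = \<phi> (h y) *\<^sub>C x" by blast
        have Ft: "F t = (\<Sum>(\<alpha>, v)\<leftarrow>ws. \<phi> v *\<^sub>C \<alpha>)"
          unfolding ws(2) linear_on_UNIV_sum_list[OF F(1)] by (simp add: F(2))
        have "(\<Sum>(\<alpha>, v)\<leftarrow>ws. \<phi> v *\<^sub>C \<alpha>) \<in> component A 1 \<and>
            product A 1 1 \<eta> (\<Sum>(\<alpha>, v)\<leftarrow>ws. \<phi> v *\<^sub>C \<alpha>) = G (\<Sum>(\<alpha>, v)\<leftarrow>ws. product A 1 1 \<eta> \<alpha> \<otimes>\<^sub>C \<theta> g v)"
          using ws(1)
        proof (induction ws)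
          case Nil
          show ?case
            using \<eta> complex_vector.subspace_0[OF subspace_component] linear_on_UNIV_simps(3)[OF G(1)] by simp
        next
          case (Cons w ws)
          obtain \<alpha> v where w: "w = (\<alpha>, v)" by (cases w)
          have \<alpha>: "\<alpha> \<in> component A 1" "\<phi> v *\<^sub>C \<alpha> \<in> component A 1"
            using Cons.prems by (auto simp: w intro: complex_vector.subspace_scale subspace_component)
          have "linear_on (component A 1) (product A 1 1 \<eta>)"
            using \<eta> by (rule linear_product)
          with \<alpha> Cons show ?case
            by (simp add: w linear_on_def linear_on_UNIV_simps(1)[OF G(1)] G(2) h
                complex_vector.subspace_add[OF subspace_component])
        qed
        then have "F t \<in> component A 1" "product A 1 1 \<eta> (F t) = 0"
          unfolding Ft zero linear_on_UNIV_simps(3)[OF G(1)] by auto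
        then show "F t \<in> cspan {\<eta>}"
          using contr rank_one_resonance_iff[OF assms(1,2) d0] \<eta> by blast
      qed
      from tensor_space_line[OF complex_vector.subspace_UNIV this]
      obtain y where "t = \<eta> \<otimes>\<^sub>C y" by blast
      then have "t = \<eta> \<otimes>\<^sub>C \<theta> g (h y)" by (simp add: h)
      with t(2) show False by blast
    qed
  qed
qed

text \<open>Every \<open>x \<otimes> v\<close> with \<open>x\<close> in \<open>U\<close> is a cocycle.  Suppose that all of them were coboundaries \<open>E w\<close>, and
  contract \<open>E\<close> with a functional \<open>\<phi>\<close> on the first factor that is \<open>1\<close> at \<open>u\<close> and \<open>0\<close> at \<open>\<eta>\<close>.  The
  resulting endomorphism of \<open>V\<close> is onto, because of the tensors \<open>u \<otimes> v\<close>, hence injective; but it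
  kills the \<open>w\<close> with \<open>E w = \<eta> \<otimes> v\<close>, so \<open>\<eta> \<otimes> v = E 0 = 0\<close>.\<close>

lemma resonance_of_isotropic:
  fixes \<theta> :: "'g::complex_vector \<Rightarrow> 'v::complex_vector \<Rightarrow> 'v"
  assumes "cdga A" and "connected_dga A" and L: "lie_algebra L" and rep: "lie_rep L \<theta>"
    and d0: "\<forall>x\<in>component A 1. differential A 1 x = 0"
    and V: "fin_dim (UNIV :: 'v set)" "\<exists>v::'v. v \<noteq> 0"
    and U: "csubspace U" "U \<subseteq> component A 1" "\<forall>x\<in>U. \<forall>y\<in>U. product A 1 1 x y = 0"
    and \<eta>: "\<eta> \<in> U" "\<eta> \<noteq> 0" and u: "u \<in> U" "u \<notin> cspan {\<eta>}"
    and \<omega>: "\<omega> \<in> flat_connections A L" "\<omega> \<in> tensor_space U (lie_space L)"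
  shows "\<omega> \<in> resonance 1 1 A L \<theta>"
proof (rule ccontr)
  assume contr: "\<omega> \<notin> resonance 1 1 A L \<theta>"
  obtain zs where zsU: "set zs \<subseteq> U \<times> lie_space L" and \<omega>_eq: "\<omega> = (\<Sum>(\<zeta>, g)\<leftarrow>zs. \<zeta> \<otimes>\<^sub>C g)"
    using tensor_space_sum_list[OF U(1) \<omega>(2)] by blast
  have zs: "set zs \<subseteq> component A 1 \<times> lie_space L" using zsU U(2) by blast
  define E where "E w = (\<Sum>(\<zeta>, g)\<leftarrow>zs. \<zeta> \<otimes>\<^sub>C \<theta> g w)" for w
  have lin_E: "linear_on UNIV E"
    using zs rep_linear(1)[OF rep] unfolding E_def case_prod_unfold
    by (intro linear_on_sum_list)
      (auto simp: linear_on_def tens_add_right tens_scaleC_right)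
  have coboundary: "\<exists>w. x \<otimes>\<^sub>C v = E w" if "x \<in> U" for x v
  proof -
    have ws: "set [(x, v)] \<subseteq> component A 1 \<times> UNIV" using that U(2) by auto
    have "(\<Sum>(\<eta>, g)\<leftarrow>zs. product A 1 1 \<eta> x \<otimes>\<^sub>C \<theta> g v) = 0"
      using zsU U(3) that by (intro sum_list_pairs_zero) auto
    then have "x \<otimes>\<^sub>C v \<in> twisted_cocycles A L \<theta> \<omega> 1"
      using twisted_cocycles_1_iff[OF assms(1) L rep d0 zs ws] by (simp add: \<omega>_eq)
    then show ?thesis
      using resonance_1_1_iff[OF assms(1,2) L rep zs] contr \<omega>(1) unfolding \<omega>_eq E_def by blast
  qed
  obtain \<phi> :: "'a \<Rightarrow> complex" where \<phi>: "linear_on UNIV \<phi>" "\<phi> u = 1" "\<forall>y\<in>cspan {\<eta>}. \<phi> y = 0"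
    using separating_functional[OF complex_vector.subspace_span u(2)] by blast
  obtain F where F: "linear_on UNIV F" "\<And>x (y :: 'v). F (x \<otimes>\<^sub>C y) = \<phi> x *\<^sub>C y"
    using contract_left[OF \<phi>(1)] by blast
  have lin: "linear_on UNIV (\<lambda>w. F (E w))"
    by (simp add: linear_on_def linear_on_UNIV_simps[OF F(1)] linear_on_UNIV_simps[OF lin_E])
  have "surj (\<lambda>w. F (E w))"
    unfolding surj_def
  proof
    fix v
    obtain w where "u \<otimes>\<^sub>C v = E w" using coboundary[OF u(1)] by blast
    from arg_cong[OF this, of F] show "\<exists>w. v = F (E w)"
      by (auto simp: F(2) \<phi>(2) scaleC_one)
  qed
  then have inj: "inj (\<lambda>w. F (E w))"
    using endo_surj_iff_inj[OF V(1) lin] by blast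
  obtain v :: 'v where "v \<noteq> 0" using V(2) by blast
  obtain w where w: "\<eta> \<otimes>\<^sub>C v = E w" using coboundary[OF \<eta>(1)] by blast
  have "F (E w) = 0"
    unfolding w[symmetric] using \<phi>(3) by (simp add: F(2) complex_vector.span_base)
  then have "w = 0"
    using injD[OF inj, of w 0] linear_on_UNIV_simps(3)[OF lin] by simp
  then have "\<eta> \<otimes>\<^sub>C v = 0"
    using w linear_on_UNIV_simps(3)[OF lin_E] by simp
  with \<eta>(2) \<open>v \<noteq> 0\<close> show False by (simp add: tens_eq_0_iff)
qed


section \<open>Connections with values in the two Lie algebras of matrices\<close>

abbreviation mat22 :: "complex \<Rightarrow> complex \<Rightarrow> complex \<Rightarrow> complex \<Rightarrow> complex ^ 2 ^ 2" where
  "mat22 a b c d \<equiv> vector [vector [a, b], vector [c, d]]"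

lemma linear_entry: "linear_on UNIV (\<lambda>M :: complex ^ 2 ^ 2. vec_nth (vec_nth M i) j)"
  by (simp add: linear_on_def scaleC_vec_nth scaleC_complex_def)

text \<open>In the basis \<open>H, X, Y\<close> the brackets are \<open>[H, X] = 2 X\<close>, \<open>[H, Y] = - 2 Y\<close>, \<open>[X, Y] = H\<close>.  Since
  products of degree one elements anticommute, the curvature of \<open>a \<otimes> H + b \<otimes> X + c \<otimes> Y\<close> is
  \<open>b c \<otimes> H + 2 a b \<otimes> X - 2 a c \<otimes> Y\<close>.  The coefficients of a traceless matrix in this basis are
  three of its entries, so contraction with the entry functionals reads them off.\<close>

lemma flat_connection_sl2_support:
  assumes "cdga A" and d0: "\<forall>x\<in>component A 1. differential A 1 x = 0"
    and L: "L \<in> {sl2, sol2}" and \<omega>: "\<omega> \<in> flat_connections A L"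
  shows "\<exists>U. csubspace U \<and> U \<subseteq> component A 1 \<and> (\<forall>x\<in>U. \<forall>y\<in>U. product A 1 1 x y = 0) \<and>
    \<omega> \<in> tensor_space U (lie_space L)"
proof -
  interpret cdga A by fact
  have lie: "lie_algebra L" using L lie_algebra_sl2 lie_algebra_sol2 by blast
  interpret lie_algebra L by (rule lie)
  let ?H = "mat22 1 0 0 (-1)" and ?X = "mat22 0 1 0 0" and ?Y = "mat22 0 0 1 0"
  have "\<exists>F. linear_on UNIV F \<and> (\<forall>(x :: 'a) (M :: complex ^ 2 ^ 2). F (x \<otimes>\<^sub>C M) = vec_nth (vec_nth M i) j *\<^sub>C x)" for i j
    by (rule contract_right[OF linear_entry])
  then obtain F where F: "linear_on UNIV (F i j)"
    "F i j (x \<otimes>\<^sub>C M) = vec_nth (vec_nth M i) j *\<^sub>C x" for i j and x :: 'a and M :: "complex ^ 2 ^ 2"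
    by metis
  define a where "a = F 1 1 \<omega>"
  define b where "b = F 1 2 \<omega>"
  define c where "c = F 2 1 \<omega>"
  have \<omega>A: "\<omega> \<in> tensor_space (component A 1) (lie_space L)"
    using \<omega> unfolding flat_connections_def by blast
  have "F i j \<omega> \<in> component A 1" for i j
    by (rule contraction_in_subspace[OF subspace_component subspace_lie_space subspace_component F(1) _ \<omega>A])
      (auto simp: F(2) intro: complex_vector.subspace_scale subspace_component)
  then have abc: "a \<in> component A 1" "b \<in> component A 1" "c \<in> component A 1"
    by (simp_all add: a_def b_def c_def)
  have c_sol2: "c = 0" if "L = sol2"
  proof -
    have "F 2 1 \<omega> \<in> {0}"
      by (rule contraction_in_subspace[OF subspace_component subspace_lie_space
            complex_vector.subspace_single_0 F(1) _ \<omega>A])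
        (auto simp: F(2) that sol2_def)
    then show ?thesis by (simp add: c_def)
  qed
  have pure: "x \<otimes>\<^sub>C M = F 1 1 (x \<otimes>\<^sub>C M) \<otimes>\<^sub>C ?H + F 1 2 (x \<otimes>\<^sub>C M) \<otimes>\<^sub>C ?X + F 2 1 (x \<otimes>\<^sub>C M) \<otimes>\<^sub>C ?Y"
    if "M \<in> lie_space L" for x :: 'a and M
  proof -
    have "Determinants.trace M = 0"
      using that L by (auto simp: sl2_def sol2_def)
    then have "M = vec_nth (vec_nth M 1) 1 *\<^sub>C ?H + vec_nth (vec_nth M 1) 2 *\<^sub>C ?X + vec_nth (vec_nth M 2) 1 *\<^sub>C ?Y"
      by (simp add: Finite_Cartesian_Product.vec_eq_iff forall_2 scaleC_vec_nth scaleC_complex_def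
          Determinants.trace_def sum_2 eq_neg_iff_add_eq_0 add.commute)
    then have "x \<otimes>\<^sub>C M = x \<otimes>\<^sub>C (vec_nth (vec_nth M 1) 1 *\<^sub>C ?H + vec_nth (vec_nth M 1) 2 *\<^sub>C ?X
        + vec_nth (vec_nth M 2) 1 *\<^sub>C ?Y)" by simp
    also have "\<dots> = F 1 1 (x \<otimes>\<^sub>C M) \<otimes>\<^sub>C ?H + F 1 2 (x \<otimes>\<^sub>C M) \<otimes>\<^sub>C ?X + F 2 1 (x \<otimes>\<^sub>C M) \<otimes>\<^sub>C ?Y"
      by (simp only: F(2) tens_add_right tens_scaleC_left tens_scaleC_right)
    finally show ?thesis .
  qed
  have \<omega>_eq: "\<omega> = a \<otimes>\<^sub>C ?H + b \<otimes>\<^sub>C ?X + c \<otimes>\<^sub>C ?Y"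
  proof -
    obtain zs where zs: "set zs \<subseteq> component A 1 \<times> lie_space L" "\<omega> = (\<Sum>(\<eta>, g)\<leftarrow>zs. \<eta> \<otimes>\<^sub>C g)"
      using flat_connections_sum_list[OF assms(1) \<omega>] .
    have "t = F 1 1 t \<otimes>\<^sub>C ?H + F 1 2 t \<otimes>\<^sub>C ?X + F 2 1 t \<otimes>\<^sub>C ?Y"
      if "t = (\<Sum>(\<eta>, g)\<leftarrow>zs. \<eta> \<otimes>\<^sub>C g)" for t
      using zs(1) that
    proof (induction zs arbitrary: t)
      case Nil
      then show ?case by (simp add: linear_on_UNIV_simps(3)[OF F(1)])
    next
      case (Cons z zs)
      obtain x M where z: "z = (x, M)" "M \<in> lie_space L"
        using Cons.prems(1) by (cases z) auto
      define s where "s = (\<Sum>(\<eta>, g)\<leftarrow>zs. \<eta> \<otimes>\<^sub>C g)"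
      have "s = F 1 1 s \<otimes>\<^sub>C ?H + F 1 2 s \<otimes>\<^sub>C ?X + F 2 1 s \<otimes>\<^sub>C ?Y"
        using Cons.prems(1) by (intro Cons.IH) (simp_all add: s_def)
      moreover have "t = x \<otimes>\<^sub>C M + s"
        using Cons.prems(2) by (simp add: z(1) s_def)
      ultimately show ?case
        using pure[OF z(2), of x]
        by (simp only: linear_on_UNIV_simps(1)[OF F(1)] tens_add_left) (simp add: algebra_simps)
    qed
    from this[OF zs(2)] show ?thesis unfolding a_def b_def c_def .
  qed
  \<comment> \<open>The basis vector \<open>Y\<close> is not in \<open>sol\<^sub>2\<close>, so its vanishing term has to be left out there.\<close>
  define zs where "zs = (if L = sol2 then [(a, ?H), (b, ?X)] else [(a, ?H), (b, ?X), (c, ?Y)])"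
  have zs: "set zs \<subseteq> component A 1 \<times> lie_space L" "\<omega> = (\<Sum>(\<eta>, g)\<leftarrow>zs. \<eta> \<otimes>\<^sub>C g)"
    using L abc c_sol2
    by (auto simp: zs_def \<omega>_eq sl2_def sol2_def Determinants.trace_def sum_2 add.assoc)
  have "curvature A L zs = 0"
    using flat_connections_iff_curvature[OF assms(1) lie zs(1)] \<omega> zs(2) by simp
  then have curv: "F i j (curvature A L zs) = 0" for i j
    by (simp add: linear_on_UNIV_simps(3)[OF F(1)])
  have br: "bracket L M N = M ** N - N ** M" "bracket sol2 M N = M ** N - N ** M" for M N
    using L by (auto simp: sl2_def sol2_def)
  have anti: "product A 1 1 b a = - product A 1 1 a b" "product A 1 1 c a = - product A 1 1 a c"
    "product A 1 1 c b = - product A 1 1 b c"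
    by (rule anticommute_degree_1, fact, fact)+
  have neg_eq: "- x = x \<longleftrightarrow> x = 0" for x :: 'a
    by (metis add_self_eq_0_iff eq_neg_iff_add_eq_0)
  note curv_simps = neg_eq add_self_eq_0_iff curvature_def linear_on_UNIV_simps[OF F(1)] F(2) d0 abc br anti square_degree_1
    matrix_matrix_mult_def sum_2
  have ab: "product A 1 1 a b = 0"
    using curv[of 1 2] c_sol2 abc(1) by (cases "L = sol2") (auto simp: zs_def curv_simps simp del: One_nat_def simp flip: scaleC_add_left)
  have ac: "product A 1 1 a c = 0"
    using curv[of 2 1] c_sol2 abc(1) by (cases "L = sol2") (auto simp: zs_def curv_simps simp del: One_nat_def simp flip: scaleC_add_left)
  have bc: "product A 1 1 b c = 0"
    using curv[of 1 1] c_sol2 abc(2) by (cases "L = sol2") (auto simp: zs_def curv_simps simp del: One_nat_def simp flip: scaleC_add_left)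
  let ?U = "cspan {a, b, c}"
  have generators: "product A 1 1 x y = 0" if "x \<in> {a, b, c}" "y \<in> {a, b, c}" for x y
    using that by (elim insertE emptyE)
      (simp_all only: ab ac bc anti square_degree_1[OF abc(1)] square_degree_1[OF abc(2)]
        square_degree_1[OF abc(3)] minus_zero)
  have "product A 1 1 x y = 0" if "x \<in> ?U" "y \<in> ?U" for x y
    by (rule product_span_zero[OF _ generators that]) (use abc in simp_all)
  moreover have "?U \<subseteq> component A 1"
    using abc by (intro complex_vector.span_minimal subspace_component) auto
  moreover have "set zs \<subseteq> ?U \<times> lie_space L"
    using zs(1) by (auto simp: zs_def complex_vector.span_base split: if_splits)
  then have "\<omega> \<in> tensor_space ?U (lie_space L)"
    unfolding zs(2) by (rule sum_list_in_tensor_space)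
  ultimately show ?thesis
    by (intro exI[of _ ?U]) (simp add: complex_vector.subspace_span)
qed

text \<open>The two cases are those of a support of dimension at most one and at least two; \<open>\<eta>\<close> and \<open>u\<close> witness
  the latter, and \<open>C\<close> exists because the support then consists of resonant elements.\<close>

lemma flat_connection_rank_one_or_isotropic:
  assumes A: "cdga A" "connected_dga A" and d0: "\<forall>x\<in>component A 1. differential A 1 x = 0"
    and \<C>: "finite \<C>" "\<forall>C\<in>\<C>. csubspace C \<and> C \<subseteq> component A 1" "rank_one_resonance 1 1 A = \<Union>\<C>"
    and L: "L \<in> {sl2, sol2}" and \<omega>: "\<omega> \<in> flat_connections A L"
  obtains (rank_one) \<eta> g where "\<eta> \<in> component A 1" "g \<in> lie_space L" "\<omega> = \<eta> \<otimes>\<^sub>C g"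
  | (isotropic) U \<eta> u C where "csubspace U" "U \<subseteq> component A 1" "\<forall>x\<in>U. \<forall>y\<in>U. product A 1 1 x y = 0"
      "\<eta> \<in> U" "\<eta> \<noteq> 0" "u \<in> U" "u \<notin> cspan {\<eta>}" "\<omega> \<in> tensor_space U (lie_space L)"
      "C \<in> \<C>" "U \<subseteq> C"
proof -
  interpret cdga A by fact
  have lie: "lie_algebra L" using L lie_algebra_sl2 lie_algebra_sol2 by blast
  obtain U where U: "csubspace U" "U \<subseteq> component A 1" "\<forall>x\<in>U. \<forall>y\<in>U. product A 1 1 x y = 0"
    and \<omega>U: "\<omega> \<in> tensor_space U (lie_space L)"
    using flat_connection_sl2_support[OF A(1) d0 L \<omega>] by blast
  show thesis
  proof (cases "\<exists>\<eta>\<in>U. U \<subseteq> cspan {\<eta>}")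
    case True
    then obtain \<eta> where \<eta>: "\<eta> \<in> U" "U \<subseteq> cspan {\<eta>}" by blast
    then have "\<omega> \<in> tensor_space (cspan {\<eta>}) (lie_space L)"
      using \<omega>U tensor_space_mono[OF \<eta>(2) subset_refl] by blast
    from tensor_space_line[OF lie_algebra.subspace_lie_space[OF lie] this]
    obtain g where "g \<in> lie_space L" "\<omega> = \<eta> \<otimes>\<^sub>C g" by blast
    with \<eta>(1) U(2) show thesis by (intro rank_one) auto
  next
    case False
    have "U \<subseteq> rank_one_resonance 1 1 A"
    proof
      fix x assume x: "x \<in> U"
      then obtain y where "y \<in> U" "y \<notin> cspan {x}" using False by blast
      with x U show "x \<in> rank_one_resonance 1 1 A"
        unfolding rank_one_resonance_iff[OF A d0] by blast
    qed
    then obtain C where C: "C \<in> \<C>" "U \<subseteq> C"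
      using subspace_covered_by_finite_union[OF \<C>(1) U(1)] \<C>(2,3) by auto
    have "0 \<in> U" by (rule complex_vector.subspace_0[OF U(1)])
    then obtain \<eta> where \<eta>: "\<eta> \<in> U" "\<eta> \<noteq> 0" using False by fastforce
    then obtain u where "u \<in> U" "u \<notin> cspan {\<eta>}" using False by blast
    from isotropic[OF U \<eta> this \<omega>U C] show thesis .
  qed
qed

lemma rank_one_tensor_in_subspace:
  assumes C: "csubspace C" and "g \<noteq> 0" and t: "\<eta> \<otimes>\<^sub>C g \<in> tensor_space C T" and T: "csubspace T"
  shows "\<eta> \<in> C"
proof -
  obtain \<phi> where \<phi>: "linear_on UNIV \<phi>" "\<phi> g = (1::complex)"
    using functional_nonzero[OF assms(2)] by blast
  obtain F where F: "linear_on UNIV F" "\<And>(x :: 'a) y. F (x \<otimes>\<^sub>C y) = \<phi> y *\<^sub>C x"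
    using contract_right[OF \<phi>(1)] by blast
  have "F (\<eta> \<otimes>\<^sub>C g) \<in> C"
    by (rule contraction_in_subspace[OF C T C F(1) _ t])
      (simp add: F(2) complex_vector.subspace_scale[OF C])
  then show ?thesis by (simp add: F(2) \<phi>(2) scaleC_one)
qed

lemma flat_connections_sl2:
  assumes A: "cdga A" "connected_dga A" and d0: "\<forall>x\<in>component A 1. differential A 1 x = 0"
    and \<C>: "finite \<C>" "\<forall>C\<in>\<C>. csubspace C \<and> C \<subseteq> component A 1" "rank_one_resonance 1 1 A = \<Union>\<C>"
    and L: "L \<in> {sl2, sol2}"
  shows "flat_connections A L =
    rank_one_flat A L \<union> (\<Union>C\<in>{C\<in>\<C>. C \<noteq> {0}}. flat_connections (sub_dga A C) L)"
proof
  have lie: "lie_algebra L" using L lie_algebra_sl2 lie_algebra_sol2 by blast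
  show "rank_one_flat A L \<union> (\<Union>C\<in>{C\<in>\<C>. C \<noteq> {0}}. flat_connections (sub_dga A C) L) \<subseteq> flat_connections A L"
    using rank_one_flat_subset[OF A(1) lie] flat_connections_sub_dga[OF A(1) lie] \<C>(2) by blast
  show "flat_connections A L \<subseteq>
      rank_one_flat A L \<union> (\<Union>C\<in>{C\<in>\<C>. C \<noteq> {0}}. flat_connections (sub_dga A C) L)"
  proof
    fix \<omega> assume \<omega>: "\<omega> \<in> flat_connections A L"
    from A d0 \<C> L \<omega> show "\<omega> \<in> rank_one_flat A L \<union> (\<Union>C\<in>{C\<in>\<C>. C \<noteq> {0}}. flat_connections (sub_dga A C) L)"
    proof (cases rule: flat_connection_rank_one_or_isotropic)
      case (rank_one \<eta> g)
      then show ?thesis using d0 unfolding rank_one_flat_def by blast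
    next
      case (isotropic U \<eta> u C)
      then have "\<omega> \<in> flat_connections (sub_dga A C) L"
        using flat_connections_sub_dga[OF A(1) lie] \<C>(2) \<omega> tensor_space_mono[OF isotropic(10) subset_refl]
        by blast
      with isotropic show ?thesis by blast
    qed
  qed
qed

text \<open>A connection of \<open>A\<^sub>C\<close> of the form \<open>\<eta> \<otimes> g\<close> with \<open>g \<noteq> 0\<close> has \<open>\<eta>\<close> in \<open>C\<close>, so \<open>\<eta>\<close> is resonant; conversely a
  resonant \<open>\<eta> \<otimes> g\<close> with \<open>\<theta> g\<close> invertible has \<open>\<eta>\<close> in some \<open>C\<close>.  The zero connection, for which \<open>C\<close> could
  be zero and \<open>\<eta>\<close> is not determined, is singular as \<open>0 \<otimes> 0\<close>.\<close>

lemma resonance_sl2: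
  fixes \<theta> :: "complex ^ 2 ^ 2 \<Rightarrow> 'v::complex_vector \<Rightarrow> 'v"
  assumes A: "cdga A" "connected_dga A" and d0: "\<forall>x\<in>component A 1. differential A 1 x = 0"
    and A1: "component A 1 \<noteq> {0}"
    and \<C>: "finite \<C>" "\<forall>C\<in>\<C>. csubspace C \<and> C \<subseteq> component A 1" "rank_one_resonance 1 1 A = \<Union>\<C>"
    and L: "L \<in> {sl2, sol2}"
    and rep: "lie_rep L \<theta>" and V: "fin_dim (UNIV :: 'v set)" "\<exists>v::'v. v \<noteq> 0"
  shows "resonance 1 1 A L \<theta> =
    rank_one_singular A L \<theta> \<union> (\<Union>C\<in>{C\<in>\<C>. C \<noteq> {0}}. flat_connections (sub_dga A C) L)"
proof -
  have lie: "lie_algebra L" using L lie_algebra_sl2 lie_algebra_sol2 by blast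
  note one = resonance_of_rank_one[OF A lie rep d0 A1 V]
  have sub: "flat_connections (sub_dga A C) L = flat_connections A L \<inter> tensor_space C (lie_space L)"
    if "C \<in> \<C>" for C
    using flat_connections_sub_dga[OF A(1) lie] \<C>(2) that by blast
  have singular: "rank_one_singular A L \<theta> = {\<eta> \<otimes>\<^sub>C g | \<eta> g. \<eta> \<in> component A 1 \<and> g \<in> lie_space L \<and> endo_det (\<theta> g) = 0}"
    using d0 unfolding rank_one_singular_def by blast
  have zero: "0 \<in> rank_one_singular A L \<theta>"
  proof -
    have g0: "0 \<in> lie_space L"
      by (rule complex_vector.subspace_0[OF lie_algebra.subspace_lie_space[OF lie]])
    have lin0: "linear_on UNIV (\<theta> 0)" by (rule rep_linear(1)[OF rep g0])
    have "\<theta> 0 v = 0" for v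
    proof -
      have "\<theta> (0 *\<^sub>C 0) v = 0 *\<^sub>C \<theta> 0 v"
        using rep_linear(2)[OF rep, of v] g0 unfolding linear_on_def by blast
      then show ?thesis by simp
    qed
    then have "\<not> inj (\<theta> 0)" using V(2) by (metis injD)
    then have "endo_det (\<theta> 0) = 0" using endo_det_eq_0_iff[OF V(1) lin0] by blast
    moreover have "0 \<in> component A 1"
      by (rule complex_vector.subspace_0[OF cdga.subspace_component[OF A(1)]])
    ultimately have "(0::'a) \<otimes>\<^sub>C (0 :: complex ^ 2 ^ 2) \<in> rank_one_singular A L \<theta>"
      unfolding singular using g0 by blast
    then show ?thesis by simp
  qed
  have singular_sub: "rank_one_singular A L \<theta> \<subseteq> resonance 1 1 A L \<theta>"
    unfolding singular using one by blast
  show ?thesis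
  proof (intro equalityI subsetI)
    fix \<omega> assume res: "\<omega> \<in> resonance 1 1 A L \<theta>"
    then have \<omega>: "\<omega> \<in> flat_connections A L" unfolding resonance_def by blast
    show "\<omega> \<in> rank_one_singular A L \<theta> \<union> (\<Union>C\<in>{C\<in>\<C>. C \<noteq> {0}}. flat_connections (sub_dga A C) L)"
      using A d0 \<C> L \<omega>
    proof (cases rule: flat_connection_rank_one_or_isotropic)
      case (rank_one \<eta> g)
      show ?thesis
      proof (cases "\<eta> = 0 \<or> endo_det (\<theta> g) = 0")
        case True
        then show ?thesis using zero rank_one unfolding singular by auto
      next
        case False
        then have "\<eta> \<in> \<Union>\<C>"
          using one[OF rank_one(1,2)] res rank_one(3) \<C>(3) by simp
        then obtain C where C: "C \<in> \<C>" "\<eta> \<in> C" by blast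
        then have "\<omega> \<in> flat_connections (sub_dga A C) L"
          using sub[OF C(1)] \<omega> tens_in_tensor_space[OF C(2) rank_one(2)] rank_one(3) by blast
        with C False show ?thesis by blast
      qed
    next
      case (isotropic U \<eta> u C)
      then have "\<omega> \<in> flat_connections (sub_dga A C) L"
        using sub \<omega> tensor_space_mono[OF isotropic(10) subset_refl] by blast
      with isotropic show ?thesis by blast
    qed
  next
    fix \<omega> assume "\<omega> \<in> rank_one_singular A L \<theta> \<union> (\<Union>C\<in>{C\<in>\<C>. C \<noteq> {0}}. flat_connections (sub_dga A C) L)"
    then show "\<omega> \<in> resonance 1 1 A L \<theta>"
    proof
      assume "\<omega> \<in> (\<Union>C\<in>{C\<in>\<C>. C \<noteq> {0}}. flat_connections (sub_dga A C) L)"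
      then obtain C where C: "C \<in> \<C>" and \<omega>: "\<omega> \<in> flat_connections A L" "\<omega> \<in> tensor_space C (lie_space L)"
        using sub by blast
      show ?thesis
        using A d0 \<C> L \<omega>(1)
      proof (cases rule: flat_connection_rank_one_or_isotropic)
        case (rank_one \<eta> g)
        show ?thesis
        proof (cases "g = 0")
          case True
          then show ?thesis using zero singular_sub rank_one(3) by auto
        next
          case False
          have "\<eta> \<in> C"
            using rank_one_tensor_in_subspace[OF _ False _ lie_algebra.subspace_lie_space[OF lie]]
              C \<C>(2) \<omega>(2) rank_one(3) by blast
          then have "\<eta> \<in> rank_one_resonance 1 1 A" using C \<C>(3) by blast
          then show ?thesis using one[OF rank_one(1,2)] rank_one(3) by blast
        qed
      next
        case (isotropic U \<eta> u C)
        then show ?thesis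
          using resonance_of_isotropic[OF A lie rep d0 V isotropic(1-7) \<omega>(1) isotropic(8)] by blast
      qed
    qed (use singular_sub in blast)
  qed
qed

theorem theorem1p4:
  fixes A :: "'a::complex_vector dga" and \<C> :: "'a set set"
  assumes "cdga A" and "one_finite A"
    and "finite \<C>" and "\<forall>C\<in>\<C>. csubspace C \<and> C \<subseteq> H1 A"
    and "rank_one_resonance 1 1 A = \<Union>\<C>"
  shows
    "(\<forall>L :: 'g::complex_vector lie. lie_algebra L \<and> fin_dim (lie_space L) \<longrightarrow>
        rank_one_flat A L \<union> (\<Union>C\<in>{C\<in>\<C>. C \<noteq> {0}}. flat_connections (sub_dga A C) L)
          \<subseteq> flat_connections A L \<and>
        (\<forall>C\<in>\<C>. zariski_closed_in (flat_connections A L) (flat_connections (sub_dga A C) L)))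
     \<and>
     ((\<forall>i. \<forall>x\<in>component A i. differential A i x = 0) \<and> component A 1 \<noteq> {0} \<longrightarrow>
        (\<forall>L\<in>{sl2, sol2}.
          flat_connections A L =
            rank_one_flat A L \<union> (\<Union>C\<in>{C\<in>\<C>. C \<noteq> {0}}. flat_connections (sub_dga A C) L) \<and>
          (\<forall>\<theta> :: complex ^ 2 ^ 2 \<Rightarrow> 'v::complex_vector \<Rightarrow> 'v.
            lie_rep L \<theta> \<and> fin_dim (UNIV :: 'v set) \<and> (\<exists>v::'v. v \<noteq> 0) \<longrightarrow>
            resonance 1 1 A L \<theta> =
              rank_one_singular A L \<theta> \<union>
              (\<Union>C\<in>{C\<in>\<C>. C \<noteq> {0}}. flat_connections (sub_dga A C) L))))"
proof -
  have \<C>: "\<forall>C\<in>\<C>. csubspace C \<and> C \<subseteq> component A 1"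
    using assms(4) unfolding H1_def by blast
  have connected: "connected_dga A"
    using assms(2) unfolding one_finite_def by blast
  show ?thesis
  proof (intro conjI allI impI ballI)
    fix L :: "'g lie"
    assume L: "lie_algebra L \<and> fin_dim (lie_space L)"
    then show "rank_one_flat A L \<union> (\<Union>C\<in>{C\<in>\<C>. C \<noteq> {0}}. flat_connections (sub_dga A C) L)
        \<subseteq> flat_connections A L"
      using rank_one_flat_subset[OF assms(1)] flat_connections_sub_dga[OF assms(1)] \<C> by blast
    show "zariski_closed_in (flat_connections A L) (flat_connections (sub_dga A C) L)" if "C \<in> \<C>" for C
      using zariski_closed_sub_dga[OF assms(1)] L \<C> that by blast
  next
    fix L :: "(complex ^ 2 ^ 2) lie"
    assume zero: "(\<forall>i. \<forall>x\<in>component A i. differential A i x = 0) \<and> component A 1 \<noteq> {0}"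
      and L: "L \<in> {sl2, sol2}"
    then have d0: "\<forall>x\<in>component A 1. differential A 1 x = 0" and A1: "component A 1 \<noteq> {0}" by blast+
    show "flat_connections A L =
        rank_one_flat A L \<union> (\<Union>C\<in>{C\<in>\<C>. C \<noteq> {0}}. flat_connections (sub_dga A C) L)"
      by (rule flat_connections_sl2[OF assms(1) connected d0 assms(3) \<C> assms(5) L])
    fix \<theta> :: "complex ^ 2 ^ 2 \<Rightarrow> 'v \<Rightarrow> 'v"
    assume "lie_rep L \<theta> \<and> fin_dim (UNIV :: 'v set) \<and> (\<exists>v::'v. v \<noteq> 0)"
    then show "resonance 1 1 A L \<theta> = rank_one_singular A L \<theta> \<union>
        (\<Union>C\<in>{C\<in>\<C>. C \<noteq> {0}}. flat_connections (sub_dga A C) L)"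
      by (intro resonance_sl2[OF assms(1) connected d0 A1 assms(3) \<C> assms(5) L]) auto
  qed
qed

end
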